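(* Let $S$ be a right reversible semitopological semigroup, let $(X,Q)$ be a locally convex space, and let $K$ be a nonempty compact convex subset of $X$. (i) If $\operatorname{LUC}(S)$ has a left invariant mean, then every jointly continuous and super asymptotically separately $Q$-nonexpansive action of $S$ on $K$ has a common fixed point. (ii) If $\operatorname{AP}(S)$ has a left invariant mean, then every separately continuous, equicontinuous and super asymptotically separately $Q$-nonexpansive action of $S$ on $K$ has a common fixed point. (iii) If $\operatorname{WAP}(S)$ has a left invariant mean, then every separately continuous, quasi-equicontinuous and super asymptotically separately $Q$-nonexpansive action of $S$ on $K$ has a common fixed point.
   Context: A semitopological semigroup is a semigroup $S$ with a Hausdorff topology such that for each fixed $t\in S$ the maps $s\mapsto ts$ and $s\mapsto st$ are continuous. A left ideal is a nonempty subset $I\subseteq S$ with $SI\subseteq I$. $S$ is right reversible if any two closed left ideals of $S$ intersect. $\operatorname{CB}(S)$ is the Banach space of bounded continuous real-valued functions on $S$ with the supremum norm. For $s\in S$, $(l_sf)(t)=f(st)$. $\operatorname{LUC}(S)$ is the space of all $f\in \operatorname{CB}(S)$ for which $s\mapsto l_sf$ from $S$ into $\operatorname{CB}(S)$ is norm continuous. $\operatorname{AP}(S)$ (resp. $\operatorname{WAP}(S)$) is the space of all $f\in\operatorname{CB}(S)$ for which $\{l_sf:s\in S\}$ is relatively compact in the norm (resp. weak) topology of $\operatorname{CB}(S)$. A left invariant mean on such a space $A$ is a functional $m\in A^*$ with $\|m\|=m(1)=1$ and $m(l_sf)=m(f)$ for all $s\in S$, $f\in A$. $(X,Q)$ denotes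 a (Hausdorff) locally convex space $X$ together with a selected family $Q$ of seminorms defining its topology; neither metrizability nor completeness is assumed. An action of $S$ on $K$ is a map $S\times K\to K$, $(s,x)\mapsto s.x$, with $(st).x=s.(t.x)$; it is separately (jointly) continuous if this map is separately (jointly) continuous. It is equicontinuous if the family of maps $\{x\mapsto s.x: s\in S\}$ is equicontinuous on $K$. It is quasi-equicontinuous if the closure of $\{x\mapsto s.x:s\in S\}$ in the product space $K^K$ (topology of pointwise convergence) consists only of continuous maps $K\to K$. It is super asymptotically separately $Q$-nonexpansive if for all $x\in K$, $t\in S$, $q\in Q$ there is a left ideal $I_x^{q,t}$ of $S$ such that $q(st.x-st.y)\le q(x-y)$ for all $s\in I_x^{q,t}$ and all $y\in K$. A common fixed point is $x_0\in K$ with $s.x_0=x_0$ for all $s\in S$. *)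

theory Defs
  imports "HOL-Analysis.Analysis"
begin

section \<open>Semitopological semigroups\<close>

class semitopological_semigroup = semigroup_mult + t2_space +
  assumes open_vimage_mult_left: "open U \<Longrightarrow> open ((\<lambda>s. t * s) -` U)"
    and open_vimage_mult_right: "open U \<Longrightarrow> open ((\<lambda>s. s * t) -` U)"

lemma continuous_on_mult_separate:
  fixes t :: "'s::semitopological_semigroup"
  shows "continuous_on UNIV (\<lambda>s. t * s)" and "continuous_on UNIV (\<lambda>s. s * t)"
  by (simp_all add: continuous_on_open_vimage open_vimage_mult_left open_vimage_mult_right)

definition left_ideal :: "'s::semigroup_mult set \<Rightarrow> bool" where
  "left_ideal I \<longleftrightarrow> I \<noteq> {} \<and> (\<forall>s. \<forall>i\<in>I. s * i \<in> I)"

definition right_reversible :: "'s::semitopological_semigroup itself \<Rightarrow> bool" where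
  "right_reversible _ \<longleftrightarrow>
    (\<forall>I J :: 's set. left_ideal I \<and> closed I \<and> left_ideal J \<and> closed J \<longrightarrow> I \<inter> J \<noteq> {})"


section \<open>Function spaces on a semitopological semigroup\<close>

definition left_translate ::
  "'s::semitopological_semigroup \<Rightarrow> ('s \<Rightarrow>\<^sub>C real) \<Rightarrow> ('s \<Rightarrow>\<^sub>C real)" where
  "left_translate s f = Bcontfun (\<lambda>t. f (s * t))"

lemma apply_left_translate [simp]: "left_translate s f t = f (s * t)"
proof -
  have "continuous_on UNIV (apply_bcontfun f \<circ> (\<lambda>t. s * t))"
    by (intro continuous_on_compose continuous_on_mult_separate continuous_on_apply_bcontfun)
  moreover have "bounded (range (\<lambda>t. f (s * t)))"
    by (rule bounded_subset [OF bounded_apply_bcontfun [of f]]) auto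
  ultimately have "(\<lambda>t. f (s * t)) \<in> bcontfun"
    by (simp add: bcontfun_def o_def)
  then show ?thesis
    by (simp add: left_translate_def Bcontfun_inverse)
qed

definition weak_topology :: "'a::real_normed_vector topology" where
  "weak_topology =
    topology_generated_by {\<phi> -` U |(\<phi> :: 'a \<Rightarrow> real) U. bounded_linear \<phi> \<and> open U}"

definition LUC :: "('s::semitopological_semigroup \<Rightarrow>\<^sub>C real) set" where
  "LUC = {f. continuous_on UNIV (\<lambda>s. left_translate s f)}"

definition AP :: "('s::semitopological_semigroup \<Rightarrow>\<^sub>C real) set" where
  "AP = {f. compact (closure (range (\<lambda>s. left_translate s f)))}"

definition WAP :: "('s::semitopological_semigroup \<Rightarrow>\<^sub>C real) set" where
  "WAP = {f. compactin weak_topology (weak_topology closure_of range (\<lambda>s. left_translate s f))}"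


section \<open>Left invariant means\<close>

text \<open>A functional on a linear subspace \<open>A\<close> is represented by a function on the ambient space of
  which only the values on \<open>A\<close> matter, so \<^const>\<open>bounded_linear\<close> and \<^const>\<open>onorm\<close> are relativised
  to \<open>A\<close>. Boundedness must be required separately, as the supremum in the norm is a
  real-valued one, which is unspecified for unbounded sets.\<close>

definition bounded_functional_on :: "'a::real_normed_vector set \<Rightarrow> ('a \<Rightarrow> real) \<Rightarrow> bool" where
  "bounded_functional_on A m \<longleftrightarrow>
    (\<forall>f\<in>A. \<forall>g\<in>A. m (f + g) = m f + m g) \<and>
    (\<forall>c. \<forall>f\<in>A. m (c *\<^sub>R f) = c * m f) \<and>
    (\<exists>C. \<forall>f\<in>A. \<bar>m f\<bar> \<le> C * norm f)"

definition functional_norm_on :: "'a::real_normed_vector set \<Rightarrow> ('a \<Rightarrow> real) \<Rightarrow> real" where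
  "functional_norm_on A m = (SUP f\<in>A. \<bar>m f\<bar> / norm f)"

definition left_invariant_mean ::
  "('s::semitopological_semigroup \<Rightarrow>\<^sub>C real) set \<Rightarrow> (('s \<Rightarrow>\<^sub>C real) \<Rightarrow> real) \<Rightarrow> bool" where
  "left_invariant_mean A m \<longleftrightarrow>
    bounded_functional_on A m \<and> functional_norm_on A m = 1 \<and> m (const_bcontfun 1) = 1 \<and>
    (\<forall>s. \<forall>f\<in>A. m (left_translate s f) = m f)"


section \<open>Locally convex spaces\<close>

definition seminorm :: "('x::real_vector \<Rightarrow> real) \<Rightarrow> bool" where
  "seminorm q \<longleftrightarrow> (\<forall>x y. q (x + y) \<le> q x + q y) \<and> (\<forall>c x. q (c *\<^sub>R x) = \<bar>c\<bar> * q x)"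

text \<open>Finite intersections are needed since \<open>Q\<close> is not assumed to be directed. The Hausdorff
  property is carried by the type class.\<close>

definition locally_convex_space :: "('x::{real_vector, t2_space} \<Rightarrow> real) set \<Rightarrow> bool" where
  "locally_convex_space Q \<longleftrightarrow>
    (\<forall>q\<in>Q. seminorm q) \<and>
    (\<forall>U. open U \<longleftrightarrow>
      (\<forall>x\<in>U. \<exists>F e. finite F \<and> F \<subseteq> Q \<and> e > 0 \<and> {y. \<forall>q\<in>F. q (y - x) < e} \<subseteq> U))"


section \<open>Actions\<close>

definition action_on :: "'x set \<Rightarrow> ('s::semigroup_mult \<Rightarrow> 'x \<Rightarrow> 'x) \<Rightarrow> bool" where
  "action_on K act \<longleftrightarrow>
    (\<forall>s. \<forall>x\<in>K. act s x \<in> K) \<and> (\<forall>s t. \<forall>x\<in>K. act (s * t) x = act s (act t x))"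

definition separately_continuous_action ::
  "'x::topological_space set \<Rightarrow> ('s::topological_space \<Rightarrow> 'x \<Rightarrow> 'x) \<Rightarrow> bool" where
  "separately_continuous_action K act \<longleftrightarrow>
    (\<forall>s. continuous_on K (act s)) \<and> (\<forall>x\<in>K. continuous_on UNIV (\<lambda>s. act s x))"

definition jointly_continuous_action ::
  "'x::topological_space set \<Rightarrow> ('s::topological_space \<Rightarrow> 'x \<Rightarrow> 'x) \<Rightarrow> bool" where
  "jointly_continuous_action K act \<longleftrightarrow> continuous_on (UNIV \<times> K) (\<lambda>(s, x). act s x)"

definition equicontinuous_action ::
  "'x::{real_vector, topological_space} set \<Rightarrow> ('s \<Rightarrow> 'x \<Rightarrow> 'x) \<Rightarrow> bool" where
  "equicontinuous_action K act \<longleftrightarrow>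
    (\<forall>x\<in>K. \<forall>V. open V \<and> 0 \<in> V \<longrightarrow>
      (\<exists>U. open U \<and> x \<in> U \<and> (\<forall>y\<in>U \<inter> K. \<forall>s. act s y - act s x \<in> V)))"

text \<open>Elements of the product space \<open>K\<^sup>K\<close> are functions that are \<^const>\<open>undefined\<close> outside \<open>K\<close>.\<close>

definition quasi_equicontinuous_action ::
  "'x::topological_space set \<Rightarrow> ('s \<Rightarrow> 'x \<Rightarrow> 'x) \<Rightarrow> bool" where
  "quasi_equicontinuous_action K act \<longleftrightarrow>
    product_topology (\<lambda>_. top_of_set K) K closure_of range (\<lambda>s. restrict (act s) K)
      \<subseteq> {f. continuous_on K f}"

definition super_asymp_sep_nonexpansive ::
  "('x::real_vector \<Rightarrow> real) set \<Rightarrow> 'x set \<Rightarrow> ('s::semigroup_mult \<Rightarrow> 'x \<Rightarrow> 'x) \<Rightarrow> bool" where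
  "super_asymp_sep_nonexpansive Q K act \<longleftrightarrow>
    (\<forall>x\<in>K. \<forall>t. \<forall>q\<in>Q. \<exists>I. left_ideal I \<and>
      (\<forall>s\<in>I. \<forall>y\<in>K. q (act (s * t) x - act (s * t) y) \<le> q (x - y)))"

definition has_common_fixed_point :: "'x set \<Rightarrow> ('s \<Rightarrow> 'x \<Rightarrow> 'x) \<Rightarrow> bool" where
  "has_common_fixed_point K act \<longleftrightarrow> (\<exists>x\<in>K. \<forall>s. act s x = x)"

end

theory Submission
  imports Defs
begin

text \<open>Let \<open>m\<close> be the mean and \<open>y \<in> K\<close>. If the functions \<open>t \<mapsto> f (t.y)\<close> with \<open>f \<in> C(K)\<close> lie in the function
  space at hand, then \<open>f \<mapsto> m (t \<mapsto> f (t.y))\<close> is an invariant positive functional on \<open>C(K)\<close>, and its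
  support \<open>F\<close> is a compact set with \<open>s.F = F\<close> for all \<open>s\<close>. By right reversibility every \<open>x \<in> K\<close> has a
  nonempty limit set \<open>\<Omega>(x)\<close>, the intersection of the closures of \<open>I.x\<close> over all closed left ideals
  \<open>I\<close>. Take a minimal nonempty compact convex \<open>A \<subseteq> K\<close> with \<open>\<Omega>(x) \<subseteq> A\<close> for all \<open>x \<in> A\<close>, and find \<open>F\<close>
  inside such an \<open>\<Omega>(x)\<close>. If \<open>F\<close> had positive \<open>q\<close>-diameter, the points of \<open>A\<close> at \<open>q\<close>-distance at most \<open>r\<close>
  from all of \<open>F\<close>, where \<open>r\<close> is smaller than the diameter, would by DeMarr's lemma form a
  nonempty set with the same properties: as \<open>s.F = F\<close>, the asymptotic nonexpansiveness gives
  \<open>q (z - y) \<le> r\<close> for \<open>z \<in> \<Omega>(x)\<close> and \<open>y \<in> F\<close>. This contradicts minimality, so \<open>F\<close> is a single fixed point.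

  That the functions \<open>t \<mapsto> f (t.y)\<close> belong to \<open>LUC\<close> and \<open>AP\<close> is a compactness argument. For \<open>WAP\<close> it
  is Grothendieck's theorem that a bounded, pointwise compact set of continuous functions on a
  compact space is weakly compact, here obtained without representing functionals by measures.\<close>

subsection \<open>Bounded convergence for functionals\<close>

text \<open>The variation |\<phi>|, evaluated at a nonnegative bound g that need not be continuous.
  The admissible G are symmetric under negation, so \<phi> G may stand in place of its absolute
  value. If g had a negative value, the supremum would run over the empty set; hence the
  nonnegativity hypotheses below.\<close>

definition abs_var :: "(('s::topological_space \<Rightarrow>\<^sub>C real) \<Rightarrow> real) \<Rightarrow> ('s \<Rightarrow> real) \<Rightarrow> real" where
  "abs_var \<phi> g = (SUP G\<in>{G. \<forall>t. \<bar>apply_bcontfun G t\<bar> \<le> g t}. \<phi> G)"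

lemma bounded_linear_le_onorm_mult:
  fixes \<phi> :: "('s::topological_space \<Rightarrow>\<^sub>C real) \<Rightarrow> real"
  assumes "bounded_linear \<phi>" "\<And>t. \<bar>apply_bcontfun G t\<bar> \<le> c"
  shows "\<phi> G \<le> onorm \<phi> * c"
proof -
  have "\<phi> G \<le> norm (\<phi> G)" by simp
  also have "\<dots> \<le> onorm \<phi> * norm G" by (rule onorm [OF assms(1)])
  also have "\<dots> \<le> onorm \<phi> * c"
    by (rule mult_left_mono) (use assms in \<open>auto intro!: norm_bound onorm_pos_le\<close>)
  finally show ?thesis .
qed

lemma abs_var_upper:
  assumes "bounded_linear \<phi>" "\<And>t. g t \<le> c" "\<And>t. \<bar>apply_bcontfun G t\<bar> \<le> g t"
  shows "\<phi> G \<le> abs_var \<phi> g"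
  unfolding abs_var_def
proof (rule cSUP_upper)
  show "bdd_above (\<phi> ` {G. \<forall>t. \<bar>apply_bcontfun G t\<bar> \<le> g t})"
    by (intro bdd_aboveI2 [where M = "onorm \<phi> * c"] bounded_linear_le_onorm_mult assms)
      (use assms(2) in \<open>auto intro: order_trans\<close>)
qed (use assms in auto)

lemma abs_var_least:
  assumes "\<And>t. 0 \<le> g t" "\<And>G. (\<And>t. \<bar>apply_bcontfun G t\<bar> \<le> g t) \<Longrightarrow> \<phi> G \<le> b"
  shows "abs_var \<phi> g \<le> b"
  unfolding abs_var_def
proof (rule cSUP_least)
  show "{G. \<forall>t. \<bar>apply_bcontfun G t\<bar> \<le> g t} \<noteq> {}"
    using assms(1) by (auto intro!: exI [of _ 0])
qed (use assms in auto)

lemma abs_var_mono: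
  assumes "bounded_linear \<phi>" "\<And>t. 0 \<le> f t" "\<And>t. f t \<le> g t" "\<And>t. g t \<le> c"
  shows "abs_var \<phi> f \<le> abs_var \<phi> g"
  by (intro abs_var_least abs_var_upper [OF assms(1)]) (use assms in \<open>auto intro: order_trans\<close>)

lemma abs_le_abs_var:
  assumes "bounded_linear \<phi>" "\<And>t. g t \<le> c" "\<And>t. \<bar>apply_bcontfun G t\<bar> \<le> g t"
  shows "\<bar>\<phi> G\<bar> \<le> abs_var \<phi> g"
proof -
  have "\<phi> (- G) = - \<phi> G"
    using assms(1) by (simp add: bounded_linear.linear linear_neg)
  then show ?thesis
    using abs_var_upper [OF assms(1,2), where G = G] abs_var_upper [OF assms(1,2), where G = "- G"] assms(3)
    by (simp add: abs_le_iff)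
qed

text \<open>If F and G are dominated by f and g, then F + G is dominated by f + g; suprema are taken
  over F and G in turn.\<close>

lemma abs_var_superadditive:
  assumes \<phi>: "bounded_linear \<phi>" and "\<And>t. 0 \<le> f t" "\<And>t. 0 \<le> g t" "\<And>t. f t + g t \<le> c"
  shows "abs_var \<phi> f + abs_var \<phi> g \<le> abs_var \<phi> (\<lambda>t. f t + g t)"
proof -
  have "abs_var \<phi> f \<le> abs_var \<phi> (\<lambda>t. f t + g t) - abs_var \<phi> g"
  proof (rule abs_var_least)
    fix F assume F: "\<And>t. \<bar>apply_bcontfun F t\<bar> \<le> f t"
    have "abs_var \<phi> g \<le> abs_var \<phi> (\<lambda>t. f t + g t) - \<phi> F"
    proof (rule abs_var_least)
      fix G assume G: "\<And>t. \<bar>apply_bcontfun G t\<bar> \<le> g t"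
      have "\<phi> (F + G) \<le> abs_var \<phi> (\<lambda>t. f t + g t)"
        by (rule abs_var_upper [OF \<phi> assms(4)])
          (use F G in \<open>auto intro: order_trans [OF abs_triangle_ineq] add_mono\<close>)
      then show "\<phi> G \<le> abs_var \<phi> (\<lambda>t. f t + g t) - \<phi> F"
        using \<phi> by (simp add: bounded_linear.linear linear_add)
    qed (use assms in auto)
    then show "\<phi> F \<le> abs_var \<phi> (\<lambda>t. f t + g t) - abs_var \<phi> g" by simp
  qed (use assms in auto)
  then show ?thesis by simp
qed

text \<open>The Riesz decomposition property: a function dominated by \<open>f + g\<close> is the sum of its truncation
  to \<open>[-f, f]\<close> and of a function dominated by \<open>g\<close>.\<close>

lemma abs_var_subadditive:
  assumes \<phi>: "bounded_linear \<phi>" and "\<And>t. 0 \<le> f t" "\<And>t. 0 \<le> g t" "\<And>t. f t + g t \<le> c"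
    and f: "continuous_on UNIV f"
  shows "abs_var \<phi> (\<lambda>t. f t + g t) \<le> abs_var \<phi> f + abs_var \<phi> g"
proof (rule abs_var_least)
  fix H assume H: "\<And>t. \<bar>apply_bcontfun H t\<bar> \<le> f t + g t"
  have fc: "f t \<le> c" and gc: "g t \<le> c" for t
    using assms(2-4) [of t] by auto
  define F where "F = Bcontfun (\<lambda>t. max (min (H t) (f t)) (- f t))"
  have "(\<lambda>t. max (min (H t) (f t)) (- f t)) \<in> bcontfun"
    unfolding bcontfun_def
    by (auto intro!: continuous_intros f boundedI [where B = c])
      (use fc assms(2) in \<open>smt (verit)\<close>)
  then have F: "F t = max (min (H t) (f t)) (- f t)" for t
    by (simp add: F_def Bcontfun_inverse)
  have "\<phi> H = \<phi> F + \<phi> (H - F)"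
    using \<phi> by (simp add: bounded_linear.linear linear_diff)
  also have "\<phi> F \<le> abs_var \<phi> f"
    by (rule abs_var_upper [OF \<phi> fc]) (use assms(2) in \<open>auto simp: F abs_le_iff max_def min_def\<close>)
  \<comment> \<open>Truncation changes H only where |H| exceeds f, and there by |H| - f \<le>
    g.\<close>
  also have "\<phi> (H - F) \<le> abs_var \<phi> g"
    by (rule abs_var_upper [OF \<phi> gc]) (use assms(2,3) H in \<open>simp add: F, smt (verit)\<close>)
  finally show "\<phi> H \<le> abs_var \<phi> f + abs_var \<phi> g" by simp
qed (use assms in auto)

lemma continuous_on_Max_abs:
  fixes f :: "'i \<Rightarrow> 'a::topological_space \<Rightarrow> real"
  assumes "finite I" "\<And>i. i \<in> I \<Longrightarrow> continuous_on K (f i)"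
  shows "continuous_on K (\<lambda>y. Max (insert 0 ((\<lambda>i. \<bar>f i y\<bar>) ` I)))"
  using assms
proof (induction I)
  case (insert i I)
  have "Max (insert 0 ((\<lambda>i. \<bar>f i y\<bar>) ` insert i I)) = max \<bar>f i y\<bar> (Max (insert 0 ((\<lambda>i. \<bar>f i y\<bar>) ` I)))" for y
    using insert(1) by (subst image_insert, subst insert_commute, subst Max_insert) auto
  then show ?case
    using insert by (auto intro!: continuous_intros)
qed auto

text \<open>The sets where h n is below e are relatively open, increase with n and cover K, so the
  largest index of a finite subcover serves.\<close>

lemma Dini_decseq:
  fixes h :: "nat \<Rightarrow> 'a::topological_space \<Rightarrow> real"
  assumes "compact K" and h: "\<And>n. continuous_on K (h n)"
    and mono: "\<And>n y. y \<in> K \<Longrightarrow> h (Suc n) y \<le> h n y"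
    and small: "\<And>y. y \<in> K \<Longrightarrow> \<exists>n. h n y < e"
  shows "\<exists>n. \<forall>y\<in>K. h n y < e"
proof -
  have "\<forall>n. \<exists>U. open U \<and> U \<inter> K = h n -` {..<e} \<inter> K"
    using h by (auto simp: continuous_on_open_invariant)
  from choice [OF this] obtain U
    where U: "\<And>n. open (U n)" "\<And>n. U n \<inter> K = h n -` {..<e} \<inter> K" by blast
  have memU: "y \<in> U n \<longleftrightarrow> h n y < e" if "y \<in> K" for y n
    using U(2) [of n] that by (auto simp: set_eq_iff)
  have cover: "K \<subseteq> (\<Union>n\<in>UNIV. U n)"
  proof
    fix y assume y: "y \<in> K"
    then obtain n where "h n y < e" using small by blast
    then show "y \<in> (\<Union>n\<in>UNIV. U n)" using memU [OF y] by auto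
  qed
  obtain N where N: "finite N" "K \<subseteq> (\<Union>n\<in>N. U n)"
    by (rule compactE_image [OF \<open>compact K\<close> U(1) cover])
  have le: "h n y \<le> h m y" if "y \<in> K" "m \<le> n" for y m n
    using that(2) by (induction rule: dec_induct) (auto intro: order_trans mono that)
  have "h (Max N) y < e" if y: "y \<in> K" for y
  proof -
    obtain n where "n \<in> N" "y \<in> U n" using subsetD [OF N(2) y] by auto
    then have "h n y < e" using memU [OF y] by simp
    moreover have "h (Max N) y \<le> h n y" using N \<open>n \<in> N\<close> by (intro le y) simp
    ultimately show ?thesis by simp
  qed
  then show ?thesis by blast
qed

text \<open>Stands in for Riesz representation and dominated convergence. If the \<open>\<bar>\<phi> (F n)\<bar>\<close> stayed above
  \<open>e\<close>, minima \<open>h n\<close> of long finite maxima of tails of \<open>\<bar>f n\<bar>\<close> would decrease to \<open>0\<close>, hence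
  uniformly, while the variation of \<open>\<phi>\<close> on them stays above \<open>e / 2\<close>.\<close>

lemma bounded_convergence:
  fixes f :: "nat \<Rightarrow> 'y::topological_space \<Rightarrow> real" and \<pi> :: "'s::topological_space \<Rightarrow> 'y"
    and \<phi> :: "('s \<Rightarrow>\<^sub>C real) \<Rightarrow> real"
  assumes \<phi>: "bounded_linear \<phi>" and K: "compact K" and \<pi>: "continuous_on UNIV \<pi>" "\<And>t. \<pi> t \<in> K"
    and f: "\<And>n. continuous_on K (f n)" and M: "\<And>n y. y \<in> K \<Longrightarrow> \<bar>f n y\<bar> \<le> M"
    and lim: "\<And>y. y \<in> K \<Longrightarrow> (\<lambda>n. f n y) \<longlonglongrightarrow> 0"
    and F: "\<And>n t. apply_bcontfun (F n) t = f n (\<pi> t)"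
    and e: "e > 0"
  shows "\<exists>n. \<bar>\<phi> (F n)\<bar> < e"
proof (rule ccontr)
  assume "\<nexists>n. \<bar>\<phi> (F n)\<bar> < e"
  then have big: "e \<le> \<bar>\<phi> (F n)\<bar>" for n by (meson not_le)
  define P where "P g = abs_var \<phi> (\<lambda>t. g (\<pi> t))" for g
  have M0: "0 \<le> M" using M [OF \<pi>(2) [of undefined], of 0] by linarith
  \<comment> \<open>The inserted 0 gives the maximum a meaning for N < n and makes it
    nonnegative.\<close>
  define G where "G n N y = Max (insert 0 ((\<lambda>i. \<bar>f i y\<bar>) ` {n..N}))" for n N :: nat and y
  have Gc: "continuous_on K (G n N)" for n N
    unfolding G_def [abs_def] by (rule continuous_on_Max_abs) (use f in auto)
  have G0: "0 \<le> G n N y" for n N y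
    unfolding G_def by (rule Max_ge) auto
  have GM: "G n N y \<le> M" if "y \<in> K" for n N y
    unfolding G_def by (rule Max.boundedI) (use that M M0 in auto)
  have Gmono: "G n N y \<le> G i N' y" if "i \<le> n" "N \<le> N'" for n N i N' y
    unfolding G_def by (rule Max_mono) (use that in auto)
  \<comment> \<open>\<open>a n\<close> plays the part of the variation at the supremum of all |f i|
    with i \<ge> n, which need not be continuous.\<close>
  define a where "a n = (SUP N. P (G n N))" for n
  have Pmono: "P g \<le> P h" if "\<And>y. y \<in> K \<Longrightarrow> 0 \<le> g y" "\<And>y. y \<in> K \<Longrightarrow> g y \<le> h y"
      "\<And>y. y \<in> K \<Longrightarrow> h y \<le> c" for g h c
    unfolding P_def by (rule abs_var_mono [OF \<phi>, where c = c]) (use that \<pi> in auto)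
  have PM: "P g \<le> onorm \<phi> * c" if "\<And>y. y \<in> K \<Longrightarrow> 0 \<le> g y" "\<And>y. y \<in> K \<Longrightarrow> g y \<le> c" for g c
    unfolding P_def
  proof (rule abs_var_least)
    show "\<phi> H \<le> onorm \<phi> * c" if "\<And>t. \<bar>apply_bcontfun H t\<bar> \<le> g (\<pi> t)" for H
      by (rule bounded_linear_le_onorm_mult [OF \<phi>])
        (rule order_trans [OF that \<open>\<And>y. y \<in> K \<Longrightarrow> g y \<le> c\<close> [OF \<pi>(2)]])
  qed (use that \<pi> in auto)
  have bdd: "bdd_above (range (\<lambda>N. P (G n N)))" for n
    by (rule bdd_aboveI2, rule PM) (use G0 GM in auto)
  have Pa: "P (G n N) \<le> a n" for n N
    unfolding a_def by (rule cSUP_upper) (use bdd in auto)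
  \<comment> \<open>These errors add up to less than e / 2.\<close>
  have "\<exists>N. a n - e / 2 ^ (n + 2) < P (G n N)" for n
  proof -
    have "a n - e / 2 ^ (n + 2) < a n" using e by simp
    then show ?thesis unfolding a_def using bdd by (subst (asm) less_cSUP_iff) auto
  qed
  then obtain N where N: "\<And>n. a n - e / 2 ^ (n + 2) < P (G n (N n))" by metis
  \<comment> \<open>\<open>h n\<close> is the minimum of the \<open>G i (N i)\<close> over i \<le>
    n, hence decreasing in n.\<close>
  define h where "h = rec_nat (G 0 (N 0)) (\<lambda>n g y. min (g y) (G (Suc n) (N (Suc n)) y))"
  have h_0: "h 0 = G 0 (N 0)" and h_Suc: "h (Suc n) = (\<lambda>y. min (h n y) (G (Suc n) (N (Suc n)) y))" for n
    by (simp_all add: h_def)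
  have hc: "continuous_on K (h n)" for n
    by (induction n) (auto simp: h_0 h_Suc intro!: continuous_intros Gc)
  have hG: "h n y \<le> G n (N n) y" for n y
    by (cases n) (auto simp: h_0 h_Suc)
  have h0: "0 \<le> h n y" for n y
    by (induction n) (auto simp: h_0 h_Suc G0)
  have hM: "h n y \<le> M" if "y \<in> K" for n y
    using hG GM that by (meson order_trans)
  \<comment> \<open>Minimum plus maximum is the sum. The maximum of \<open>h n\<close> and the next
    G lies below a longer maximum starting at n, whose variation is at most \<open>a n\<close>; so
    the new minimum loses only the error allowed in the choice of \<open>N (Suc n)\<close>.\<close>
  have Ph: "a n - (\<Sum>i\<le>n. e / 2 ^ (i + 2)) \<le> P (h n)" for n
  proof (induction n)
    case 0
    then show ?case using N [of 0] by (simp add: h_0)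
  next
    case (Suc n)
    let ?G = "G (Suc n) (N (Suc n))"
    have sum_le: "h n (\<pi> t) + ?G (\<pi> t) \<le> 2 * M" for t
      using hM [OF \<pi>(2), of n t] GM [OF \<pi>(2), of "Suc n" "N (Suc n)" t] by linarith
    then have max_le: "h (Suc n) (\<pi> t) + max (h n (\<pi> t)) (?G (\<pi> t)) \<le> 2 * M" for t
      by (simp add: h_Suc min_def max_def add.commute)
    have "P (h n) + P ?G \<le> P (\<lambda>y. h n y + ?G y)"
      unfolding P_def
      by (rule abs_var_superadditive [OF \<phi>, where c = "2 * M"]) (use h0 G0 sum_le in auto)
    also have "\<dots> = P (\<lambda>y. h (Suc n) y + max (h n y) (?G y))"
      by (rule arg_cong [where f = P]) (auto simp: h_Suc max_def min_def)
    also have "\<dots> \<le> P (h (Suc n)) + P (\<lambda>y. max (h n y) (?G y))"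
      unfolding P_def
      by (rule abs_var_subadditive [OF \<phi>, where c = "2 * M"])
        (use h0 max_le \<pi> in \<open>auto intro!: continuous_on_compose2 [OF hc] simp: le_max_iff_disj\<close>)
    also have "P (\<lambda>y. max (h n y) (?G y)) \<le> P (G n (max (N n) (N (Suc n))))"
      by (rule Pmono [where c = M])
        (use h0 GM order_trans [OF hG Gmono [OF order_refl max.cobounded1]]
          Gmono [of n "Suc n" "N (Suc n)" "max (N n) (N (Suc n))"] in \<open>simp_all add: le_max_iff_disj\<close>)
    also have "\<dots> \<le> a n" by (rule Pa)
    finally show ?case using Suc N [of "Suc n"] by simp
  qed
  have ea: "e \<le> a n" for n
  proof -
    have "e \<le> \<bar>\<phi> (F n)\<bar>" by (rule big)
    also have "\<dots> \<le> P (G n n)"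
      unfolding P_def by (rule abs_le_abs_var [OF \<phi>, where c = M])
        (use GM \<pi> in auto, simp add: F G_def)
    also have "\<dots> \<le> a n" by (rule Pa)
    finally show ?thesis .
  qed
  have geometric: "(\<Sum>i\<le>n. e / 2 ^ (i + 2)) = e / 2 - e / 2 ^ (n + 2)" for n
    by (induction n) (auto simp: field_simps)
  have Phe: "e / 2 \<le> P (h n)" for n
  proof -
    have "0 \<le> e / 2 ^ (n + 2)" using e by simp
    then have "e / 2 \<le> e - (e / 2 - e / 2 ^ (n + 2))" by (simp only: field_sum_of_halves le_diff_eq)
    also have "\<dots> \<le> a n - (e / 2 - e / 2 ^ (n + 2))" by (rule diff_right_mono [OF ea])
    also have "\<dots> \<le> P (h n)" using Ph [of n] by (simp only: geometric)
    finally show ?thesis .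
  qed
  \<comment> \<open>Makes the variation at a function below d at most e / 4, against the lower bound
    e / 2; the added 1 excludes division by zero.\<close>
  define d where "d = e / (4 * (onorm \<phi> + 1))"
  have on: "0 \<le> onorm \<phi>" by (rule onorm_pos_le [OF \<phi>])
  then have d: "d > 0" using e by (simp add: d_def)
  have "\<exists>n. \<forall>y\<in>K. h n y < d"
  proof (rule Dini_decseq [OF K hc])
    fix y assume y: "y \<in> K"
    from LIMSEQ_D [OF lim [OF y] d] obtain n where n: "\<And>k. k \<ge> n \<Longrightarrow> \<bar>f k y\<bar> < d" by auto
    have "G n (N n) y < d" unfolding G_def by (subst Max_less_iff) (use n d in auto)
    then show "\<exists>n. h n y < d" using hG by (meson order.strict_trans1)
  qed (auto simp: h_Suc)
  then obtain n where "\<forall>y\<in>K. h n y < d" by blast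
  then have "P (h n) \<le> onorm \<phi> * d" by (intro PM) (auto simp: h0 less_imp_le)
  also have "\<dots> \<le> e / 4"
    using on e by (simp add: d_def divide_simps algebra_simps)
  finally show False using Phe [of n] e by simp
qed

subsection \<open>Grothendieck's theorem on weak continuity\<close>

lemma continuous_map_metricI:
  fixes g :: "'a \<Rightarrow> 'b::metric_space"
  assumes "\<And>x e. x \<in> topspace X \<Longrightarrow> 0 < e \<Longrightarrow>
    \<exists>U. openin X U \<and> x \<in> U \<and> (\<forall>y\<in>U. dist (g y) (g x) < e)"
  shows "continuous_map X euclidean g"
  unfolding continuous_map_eq_topcontinuous_at topcontinuous_at_def
proof (intro ballI conjI allI impI)
  fix x V assume x: "x \<in> topspace X" and "openin euclidean V \<and> g x \<in> V"
  then obtain e where e: "e > 0" "\<And>z. dist z (g x) < e \<Longrightarrow> z \<in> V"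
    by (auto simp: open_dist)
  from assms [OF x e(1)] obtain U where "openin X U" "x \<in> U" "\<And>y. y \<in> U \<Longrightarrow> dist (g y) (g x) < e"
    by blast
  then show "\<exists>U. openin X U \<and> x \<in> U \<and> (\<forall>y\<in>U. g y \<in> V)"
    using e(2) by blast
qed auto

lemma continuous_map_realE:
  fixes g :: "'a \<Rightarrow> real"
  assumes "continuous_map X euclideanreal g" "x \<in> topspace X" "0 < e"
  obtains U where "openin X U" "x \<in> U" "\<And>y. y \<in> U \<Longrightarrow> \<bar>g y - g x\<bar> < e"
proof
  show "openin X {y \<in> topspace X. g y \<in> ball (g x) e}"
    using assms(1) by (rule openin_continuous_map_preimage) auto
qed (use assms in \<open>auto simp: dist_real_def abs_minus_commute\<close>)

definition cluster_point :: "'a topology \<Rightarrow> (nat \<Rightarrow> 'a) \<Rightarrow> 'a \<Rightarrow> bool" where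
  "cluster_point X p z \<longleftrightarrow> z \<in> topspace X \<and> (\<forall>U N. openin X U \<and> z \<in> U \<longrightarrow> (\<exists>n\<ge>N. p n \<in> U))"

lemma cluster_point_exists:
  fixes p :: "nat \<Rightarrow> 'a"
  assumes "compact_space X" "\<And>n. p n \<in> topspace X"
  shows "\<exists>z. cluster_point X p z"
proof -
  have "(\<Inter>N. X closure_of (p ` {N..})) \<noteq> {}"
  proof (rule compact_space_imp_nest [OF assms(1)])
    show "X closure_of (p ` {N..}) \<noteq> {}" for N
      using assms(2) closure_of_subset [of "p ` {N..}" X] by auto
    show "decseq (\<lambda>N. X closure_of (p ` {N..}))"
      by (intro decseq_SucI closure_of_mono image_mono) auto
  qed auto
  then obtain z where z: "\<And>N. z \<in> X closure_of (p ` {N..})" by blast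
  have "cluster_point X p z"
    unfolding cluster_point_def
  proof (intro conjI allI impI)
    show "z \<in> topspace X" using z [of 0] by (simp add: in_closure_of)
    show "\<exists>n\<ge>N. p n \<in> U" if "openin X U \<and> z \<in> U" for U N
      using z [of N] that unfolding in_closure_of by (metis atLeast_iff imageE)
  qed
  then show ?thesis ..
qed

text \<open>The sequence comes close to z infinitely often, and there g is close to g z. Cluster
  points stand in for limits of subsequences, since a sequence in a compact space need not have a
  convergent one.\<close>

lemma cluster_point_limit:
  fixes g :: "'a \<Rightarrow> real"
  assumes z: "cluster_point X p z" and g: "continuous_map X euclideanreal g"
    and lim: "(\<lambda>n. g (p n)) \<longlonglongrightarrow> c"
  shows "g z = c"
proof (rule ccontr)
  assume "g z \<noteq> c"
  then have d: "\<bar>g z - c\<bar> / 2 > 0" by simp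
  have "z \<in> topspace X" using z by (simp add: cluster_point_def)
  from continuous_map_realE [OF g this d] obtain U
    where U: "openin X U" "z \<in> U" "\<And>y. y \<in> U \<Longrightarrow> \<bar>g y - g z\<bar> < \<bar>g z - c\<bar> / 2" by blast
  from LIMSEQ_D [OF lim d] obtain N where N: "\<And>n. n \<ge> N \<Longrightarrow> \<bar>g (p n) - c\<bar> < \<bar>g z - c\<bar> / 2" by auto
  obtain n where "n \<ge> N" "p n \<in> U" using z U(1,2) unfolding cluster_point_def by blast
  then have "\<bar>g (p n) - g z\<bar> < \<bar>g z - c\<bar> / 2" "\<bar>g (p n) - c\<bar> < \<bar>g z - c\<bar> / 2"
    using U(3) N by auto
  moreover have "\<bar>g z - c\<bar> \<le> \<bar>g (p n) - g z\<bar> + \<bar>g (p n) - c\<bar>" by linarith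
  ultimately show False by simp
qed

text \<open>As A is finite, each z has a neighbourhood on which all f p differ from f p z by less
  than d; a finite subcover yields Y.\<close>

lemma finite_net:
  fixes f :: "'p \<Rightarrow> 'a::topological_space \<Rightarrow> real"
  assumes K: "compact K" and "finite A" and f: "\<And>p. p \<in> A \<Longrightarrow> continuous_on K (f p)" and d: "d > 0"
  obtains Y where "finite Y" "Y \<subseteq> K" "\<And>y. y \<in> K \<Longrightarrow> \<exists>z\<in>Y. \<forall>p\<in>A. \<bar>f p y - f p z\<bar> < d"
proof -
  have "\<forall>z. \<exists>U. z \<in> K \<longrightarrow> open U \<and> z \<in> U \<and> (\<forall>y\<in>U \<inter> K. \<forall>p\<in>A. \<bar>f p y - f p z\<bar> < d)"
  proof
    fix z
    show "\<exists>U. z \<in> K \<longrightarrow> open U \<and> z \<in> U \<and> (\<forall>y\<in>U \<inter> K. \<forall>p\<in>A. \<bar>f p y - f p z\<bar> < d)"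
    proof (cases "z \<in> K")
      case True
      have "\<forall>\<^sub>F y in at z within K. \<bar>f p y - f p z\<bar> < d" if "p \<in> A" for p
        using tendstoD [of "f p" "f p z" "at z within K" d] f [OF that] True d
        by (simp add: continuous_on_def dist_real_def)
      then have "\<forall>\<^sub>F y in at z within K. \<forall>p\<in>A. \<bar>f p y - f p z\<bar> < d"
        using \<open>finite A\<close> by (simp add: eventually_ball_finite)
      then obtain U where U: "open U" "z \<in> U"
        "\<And>y. y \<in> U \<Longrightarrow> y \<noteq> z \<Longrightarrow> y \<in> K \<Longrightarrow> \<forall>p\<in>A. \<bar>f p y - f p z\<bar> < d"
        unfolding eventually_at_topological by blast
      then have "\<forall>p\<in>A. \<bar>f p y - f p z\<bar> < d" if "y \<in> U \<inter> K" for y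
        using that d by (cases "y = z") auto
      with U show ?thesis by blast
    qed auto
  qed
  from choice [OF this] obtain U where U: "\<And>z. z \<in> K \<Longrightarrow> open (U z)" "\<And>z. z \<in> K \<Longrightarrow> z \<in> U z"
    "\<And>z y p. z \<in> K \<Longrightarrow> y \<in> U z \<Longrightarrow> y \<in> K \<Longrightarrow> p \<in> A \<Longrightarrow> \<bar>f p y - f p z\<bar> < d"
    by blast
  have "K \<subseteq> (\<Union>z\<in>K. U z)" using U(2) by auto
  from compactE_image [OF K U(1) this] obtain Y where Y: "Y \<subseteq> K" "finite Y" "K \<subseteq> (\<Union>z\<in>Y. U z)"
    by auto
  show ?thesis
  proof (rule that [OF Y(2,1)])
    fix y assume y: "y \<in> K"
    then obtain z where "z \<in> Y" "y \<in> U z" using Y(3) by auto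
    then show "\<exists>z\<in>Y. \<forall>p\<in>A. \<bar>f p y - f p z\<bar> < d"
      using U(3) Y(1) y by (intro bexI [of _ z]) auto
  qed
qed

lemma abs_less_inverse_imp_tendsto:
  fixes x :: "nat \<Rightarrow> real"
  assumes "\<And>n. n \<ge> m \<Longrightarrow> \<bar>x n - c\<bar> < 1 / real (Suc n)"
  shows "x \<longlonglongrightarrow> c"
proof (rule LIM_zero_cancel, rule Lim_null_comparison)
  show "\<forall>\<^sub>F n in sequentially. norm (x n - c) \<le> 1 / real (Suc n)"
    using assms by (auto simp: eventually_sequentially less_imp_le intro!: exI [of _ m])
  show "(\<lambda>n. 1 / real (Suc n)) \<longlonglongrightarrow> 0"
    using LIMSEQ_inverse_real_of_nat by (simp add: inverse_eq_divide)
qed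

text \<open>If \<open>\<phi>\<close> stays away from \<open>\<phi> (F p0)\<close> arbitrarily close to \<open>p0\<close>, choose inductively points \<open>p n\<close>
  where this happens together with finite sets \<open>Y n\<close> such that \<open>B (p n) - B p0\<close> is small on \<open>Y n\<close>
  and the previously chosen functions do not distinguish \<open>Y n\<close> from \<open>K\<close>, up to a small error.
  Passing to cluster points on both sides shows that \<open>B (p n) \<longlonglongrightarrow> B p0\<close> pointwise on \<open>K\<close>, and
  bounded convergence applies. Bounded convergence is not available for nets, which is why
  a sequence has to be extracted.\<close>

lemma weakly_continuous_of_separately_continuous:
  fixes B :: "'p \<Rightarrow> 'y::topological_space \<Rightarrow> real" and \<pi> :: "'s::topological_space \<Rightarrow> 'y"
    and \<phi> :: "('s \<Rightarrow>\<^sub>C real) \<Rightarrow> real"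
  assumes \<phi>: "bounded_linear \<phi>" and X: "compact_space X" and K: "compact K"
    and \<pi>: "continuous_on UNIV \<pi>" "\<And>t. \<pi> t \<in> K"
    and BX: "\<And>y. y \<in> K \<Longrightarrow> continuous_map X euclideanreal (\<lambda>p. B p y)"
    and BK: "\<And>p. p \<in> topspace X \<Longrightarrow> continuous_on K (B p)"
    and M: "\<And>p y. p \<in> topspace X \<Longrightarrow> y \<in> K \<Longrightarrow> \<bar>B p y\<bar> \<le> M"
    and F: "\<And>p t. p \<in> topspace X \<Longrightarrow> apply_bcontfun (F p) t = B p (\<pi> t)"
  shows "continuous_map X euclideanreal (\<lambda>p. \<phi> (F p))"
proof (rule continuous_map_metricI, rule ccontr)
  fix p0 and e :: real
  assume p0: "p0 \<in> topspace X" and e: "0 < e"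
    and contra: "\<not> (\<exists>U. openin X U \<and> p0 \<in> U \<and> (\<forall>p\<in>U. dist (\<phi> (F p)) (\<phi> (F p0)) < e))"
  define D where "D p y = B p y - B p0 y" for p y
  have DX: "continuous_map X euclideanreal (\<lambda>p. D p y)" if "y \<in> K" for y
    unfolding D_def by (intro continuous_map_diff BX that) auto
  have DK: "continuous_on K (D p)" if "p \<in> topspace X" for p
    unfolding D_def [abs_def] by (intro continuous_on_diff BK that p0)
  have near: "\<exists>p\<in>topspace X. (\<forall>y\<in>Y. \<bar>D p y\<bar> < d) \<and> e \<le> \<bar>\<phi> (F p) - \<phi> (F p0)\<bar>"
    if Y: "finite Y" "Y \<subseteq> K" and d: "d > 0" for Y d
  proof -
    define U where "U = topspace X \<inter> (\<Inter>y\<in>Y. {p \<in> topspace X. D p y \<in> ball 0 d})"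
    have "openin X U"
      unfolding U_def
    proof (cases "Y = {}")
      case False
      have "openin X (\<Inter>y\<in>Y. {p \<in> topspace X. D p y \<in> ball 0 d})"
        by (intro openin_INT2 Y(1) False openin_continuous_map_preimage [OF DX]) (use Y in auto)
      then show "openin X (topspace X \<inter> (\<Inter>y\<in>Y. {p \<in> topspace X. D p y \<in> ball 0 d}))"
        by blast
    qed auto
    moreover have "p0 \<in> U" using p0 d by (simp add: U_def D_def)
    ultimately obtain p where "p \<in> U" "e \<le> \<bar>\<phi> (F p) - \<phi> (F p0)\<bar>"
      using contra unfolding dist_real_def by (meson not_le)
    then show ?thesis by (intro bexI [of _ p]) (auto simp: U_def)
  qed
  \<comment> \<open>The state holds the points chosen so far, the test points in K and the newest
    point. Under \<open>R\<close> the new test points contain a net for the old A, and the new point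
    is close to p0 on them.\<close>
  define P where "P = (\<lambda>(A, Y, p :: 'p). finite A \<and> A \<subseteq> topspace X \<and> p0 \<in> A \<and> finite Y \<and> Y \<subseteq> K)"
  define R where "R n = (\<lambda>(A, Y, p :: 'p) (A', Y', p'). p' \<in> topspace X \<and> A' = insert p' A \<and> Y \<subseteq> Y' \<and>
      (\<forall>y\<in>K. \<exists>y'\<in>Y'. \<forall>q\<in>A. \<bar>B q y - B q y'\<bar> < 1 / real (Suc n)) \<and>
      (\<forall>y\<in>Y'. \<bar>D p' y\<bar> < 1 / real (Suc n)) \<and> e \<le> \<bar>\<phi> (F p') - \<phi> (F p0)\<bar>)" for n :: nat
  have "\<exists>f. \<forall>n. P (f n) \<and> R n (f n) (f (Suc n))"
  proof (rule dependent_nat_choice)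
    show "\<exists>x. P x"
      by (rule exI [of _ "({p0}, {}, p0)"]) (simp add: P_def p0)
    fix x n assume "P x"
    then obtain A Y p where x: "x = (A, Y, p)" and A: "finite A" "A \<subseteq> topspace X" "p0 \<in> A"
      and Y: "finite Y" "Y \<subseteq> K" by (cases x) (auto simp: P_def)
    obtain Z where Z: "finite Z" "Z \<subseteq> K"
      "\<And>y. y \<in> K \<Longrightarrow> \<exists>y'\<in>Z. \<forall>q\<in>A. \<bar>B q y - B q y'\<bar> < 1 / real (Suc n)"
      by (rule finite_net [OF K A(1), of B "1 / real (Suc n)"]) (use BK A in auto)
    obtain q where q: "q \<in> topspace X" "\<forall>y\<in>Y \<union> Z. \<bar>D q y\<bar> < 1 / real (Suc n)"
      "e \<le> \<bar>\<phi> (F q) - \<phi> (F p0)\<bar>"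
      using near [of "Y \<union> Z" "1 / real (Suc n)"] Y Z by auto
    have "P (insert q A, Y \<union> Z, q)" using A Y Z q by (simp add: P_def)
    moreover have "R n x (insert q A, Y \<union> Z, q)"
      unfolding R_def x using q Z(3) by simp blast
    ultimately show "\<exists>y. P y \<and> R n x y" by blast
  qed
  then obtain f where f: "\<And>n. P (f n)" "\<And>n. R n (f n) (f (Suc n))" by blast
  define A where "A n = fst (f n)" for n
  \<comment> \<open>The index is shifted so that \<open>Y n\<close> is a net for \<open>A n\<close>
    and \<open>p n\<close> is the point that turns \<open>A n\<close> into
    \<open>A (Suc n)\<close>.\<close>
  define Y where "Y n = fst (snd (f (Suc n)))" for n
  define p where "p n = snd (snd (f (Suc n)))" for n
  have p0A: "p0 \<in> A n" and YK: "Y n \<subseteq> K" and AX: "A n \<subseteq> topspace X" for n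
    using f(1) [of n] f(1) [of "Suc n"] by (auto simp: P_def A_def Y_def split: prod.splits)
  have pX: "p n \<in> topspace X" and A_Suc: "A (Suc n) = insert (p n) (A n)"
    and net: "\<And>y. y \<in> K \<Longrightarrow> \<exists>y'\<in>Y n. \<forall>q\<in>A n. \<bar>B q y - B q y'\<bar> < 1 / real (Suc n)"
    and small: "\<And>y. y \<in> Y n \<Longrightarrow> \<bar>D (p n) y\<bar> < 1 / real (Suc n)"
    and big: "e \<le> \<bar>\<phi> (F (p n)) - \<phi> (F p0)\<bar>" for n
    using f(2) [of n] by (auto simp: R_def A_def Y_def p_def split: prod.splits)
  have "Y n \<subseteq> Y (Suc n)" for n
    using f(2) [of "Suc n"] by (auto simp: R_def Y_def split: prod.splits)
  then have Ymono: "Y m \<subseteq> Y n" if "m \<le> n" for m n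
    by (rule lift_Suc_mono_le [OF _ that])
  have Amono: "A m \<subseteq> A n" if "m \<le> n" for m n
    by (rule lift_Suc_mono_le [OF _ that]) (auto simp: A_Suc)
  \<comment> \<open>Double limit argument: z is a cluster point of a bad subsequence, w one of test
    points approximating y. Comparing B at z and w shows D z y = 0, although |D| at y stays above
    \<delta> along the subsequence.\<close>
  have lim: "(\<lambda>n. D (p n) y) \<longlonglongrightarrow> 0" if y: "y \<in> K" for y
  proof (rule ccontr)
    assume "\<not> (\<lambda>n. D (p n) y) \<longlonglongrightarrow> 0"
    then obtain \<delta> where \<delta>: "\<delta> > 0" "\<forall>m. \<exists>n\<ge>m. \<delta> \<le> \<bar>D (p n) y\<bar>"
      by (auto simp: LIMSEQ_iff not_less)
    from choice [OF \<delta>(2)] obtain r where r: "\<And>m. m \<le> r m" "\<And>m. \<delta> \<le> \<bar>D (p (r m)) y\<bar>" by blast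
    obtain z where z: "cluster_point X (\<lambda>m. p (r m)) z"
      using cluster_point_exists [OF X, of "\<lambda>m. p (r m)"] pX by blast
    then have zX: "z \<in> topspace X" by (simp add: cluster_point_def)
    have "\<forall>n. \<exists>y'. y' \<in> Y n \<and> (\<forall>q\<in>A n. \<bar>B q y - B q y'\<bar> < 1 / real (Suc n))"
      using net [OF y] by blast
    from choice [OF this] obtain v where v: "\<And>n. v n \<in> Y n"
      "\<And>n q. q \<in> A n \<Longrightarrow> \<bar>B q y - B q (v n)\<bar> < 1 / real (Suc n)" by blast
    have vK: "v n \<in> K" for n using v(1) YK by blast
    have "compact_space (top_of_set K)"
      using K by (simp add: compact_space_subtopology)
    then obtain w where w: "cluster_point (top_of_set K) v w"
      using cluster_point_exists [of "top_of_set K" v] vK by auto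
    then have wK: "w \<in> K" by (simp add: cluster_point_def)
    \<comment> \<open>A chosen q lies in \<open>A n\<close> for all large n, so that v n imitates y
      for it with vanishing error.\<close>
    have Bw: "B q w = B q y" if q: "q \<in> A m" for q m
    proof (rule cluster_point_limit [OF w])
      show "continuous_map (top_of_set K) euclideanreal (B q)"
        using BK AX q by auto
      show "(\<lambda>n. B q (v n)) \<longlonglongrightarrow> B q y"
      proof (rule abs_less_inverse_imp_tendsto)
        fix n assume "m \<le> n"
        then have "q \<in> A n" using Amono q by blast
        then show "\<bar>B q (v n) - B q y\<bar> < 1 / real (Suc n)"
          using v(2) [of q n] by (simp add: abs_minus_commute)
      qed
    qed
    \<comment> \<open>For n \<ge> m the point v m belongs to \<open>Y (r n)\<close>, on which
      \<open>p (r n)\<close> is close to p0.\<close>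
    have "D z (v m) = 0" for m
    proof (rule cluster_point_limit [OF z DX [OF vK]])
      show "(\<lambda>n. D (p (r n)) (v m)) \<longlonglongrightarrow> 0"
      proof (rule abs_less_inverse_imp_tendsto)
        fix n assume "m \<le> n"
        then have "v m \<in> Y (r n)" using Ymono v(1) r(1) [of n] by (meson order_trans subsetD)
        then have "\<bar>D (p (r n)) (v m)\<bar> < 1 / real (Suc (r n))" by (rule small)
        also have "\<dots> \<le> 1 / real (Suc n)" using r(1) [of n] by (simp add: frac_le)
        finally show "\<bar>D (p (r n)) (v m) - 0\<bar> < 1 / real (Suc n)" by simp
      qed
    qed
    then have Dzw: "D z w = 0"
      by (intro cluster_point_limit [OF w]) (use DK zX in auto)
    \<comment> \<open>Every \<open>p n\<close> takes equal values at y and w, and this passes to z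
      by continuity in the first variable.\<close>
    have "B z y - B z w = 0"
    proof (rule cluster_point_limit [OF z])
      show "continuous_map X euclideanreal (\<lambda>q. B q y - B q w)"
        by (intro continuous_map_diff BX y wK)
      have "B (p n) w = B (p n) y" for n by (rule Bw [of _ "Suc n"]) (simp add: A_Suc)
      then show "(\<lambda>n. B (p (r n)) y - B (p (r n)) w) \<longlonglongrightarrow> 0" by simp
    qed
    then have Dzy: "D z y = 0" using Dzw Bw [OF p0A] by (simp add: D_def)
    from continuous_map_realE [OF DX [OF y] zX \<delta>(1)] obtain U
      where U: "openin X U" "z \<in> U" "\<And>q. q \<in> U \<Longrightarrow> \<bar>D q y - D z y\<bar> < \<delta>" by blast
    then obtain m where "p (r m) \<in> U" using z unfolding cluster_point_def by blast
    then show False using U(3) [of "p (r m)"] r(2) [of m] Dzy by simp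
  qed
  have "\<exists>n. \<bar>\<phi> (F (p n) - F p0)\<bar> < e"
  proof (rule bounded_convergence [OF \<phi> K \<pi> _ _ lim _ e])
    show "continuous_on K (D (p n))" for n by (rule DK [OF pX])
    show "\<bar>D (p n) y\<bar> \<le> 2 * M" if "y \<in> K" for n y
      using M [OF pX that, of n] M [OF p0 that] unfolding D_def by linarith
    show "apply_bcontfun (F (p n) - F p0) t = D (p n) (\<pi> t)" for n t
      using F pX p0 by (simp add: D_def)
  qed
  then show False
    using big \<phi> by (simp add: bounded_linear.linear linear_diff not_le [symmetric])
qed

subsection \<open>Locally convex spaces\<close>

lemma seminorm_triangle: "seminorm q \<Longrightarrow> q (x - z) \<le> q (x - y) + q (y - z)"
  unfolding seminorm_def by (metis diff_add_cancel add_diff_eq diff_add_eq)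

lemma seminorm_minus_commute: "seminorm q \<Longrightarrow> q (x - y) = q (y - x)"
  unfolding seminorm_def by (metis abs_minus abs_one minus_diff_eq mult_1 scaleR_minus1_left)

lemma seminorm_zero: "seminorm q \<Longrightarrow> q 0 = 0"
  unfolding seminorm_def by (metis abs_zero mult_zero_left scaleR_zero_left)

lemma seminorm_sum:
  assumes "seminorm q" "finite I"
  shows "q (\<Sum>i\<in>I. f i) \<le> (\<Sum>i\<in>I. q (f i))"
  using assms(2)
proof (induction I)
  case empty
  then show ?case using seminorm_zero [OF assms(1)] by simp
next
  case (insert i I)
  then show ?case using assms(1) unfolding seminorm_def by (simp, smt (verit))
qed

locale lcs =
  fixes Q :: "('x::{real_vector, t2_space} \<Rightarrow> real) set"
  assumes lcs: "locally_convex_space Q"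
begin

lemma seminorm: "q \<in> Q \<Longrightarrow> seminorm q"
  using lcs by (simp add: locally_convex_space_def)

lemma open_iff:
  "open U \<longleftrightarrow> (\<forall>x\<in>U. \<exists>F e. finite F \<and> F \<subseteq> Q \<and> e > 0 \<and> {y. \<forall>q\<in>F. q (y - x) < e} \<subseteq> U)"
  using lcs unfolding locally_convex_space_def by blast

lemma open_seminorm_ball:
  assumes "q \<in> Q"
  shows "open {y. q (y - x) < e}"
  unfolding open_iff
proof
  fix y assume y: "y \<in> {y. q (y - x) < e}"
  have "q (z - x) < e" if "q (z - y) < e - q (y - x)" for z
    using seminorm_triangle [OF seminorm [OF assms], of z x y] that by simp
  then show "\<exists>F d. finite F \<and> F \<subseteq> Q \<and> d > 0 \<and> {z. \<forall>q\<in>F. q (z - y) < d} \<subseteq> {y. q (y - x) < e}"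
    using y assms by (intro exI [of _ "{q}"] exI [of _ "e - q (y - x)"]) auto
qed

lemma continuous_on_seminorm:
  assumes "q \<in> Q"
  shows "continuous_on S (\<lambda>y. q (y - x))"
proof -
  have "((\<lambda>y. q (y - x)) \<longlongrightarrow> q (z - x)) (at z)" for z
  proof (rule tendstoI)
    fix e :: real assume e: "e > 0"
    have "dist (q (y - x)) (q (z - x)) < e" if "q (y - z) < e" for y
      using that seminorm_triangle [OF seminorm [OF assms], of y x z]
        seminorm_triangle [OF seminorm [OF assms], of z x y]
        seminorm_minus_commute [OF seminorm [OF assms], of y z]
      by (simp add: dist_real_def abs_less_iff)
    then show "\<forall>\<^sub>F y in at z. dist (q (y - x)) (q (z - x)) < e"
      unfolding eventually_at_topological
      using open_seminorm_ball [OF assms, of z e] e seminorm_zero [OF seminorm [OF assms]]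
      by (intro exI [of _ "{y. q (y - z) < e}"]) auto
  qed
  then show ?thesis
    by (simp add: continuous_at_imp_continuous_on isCont_def)
qed

lemma separating_seminorm:
  assumes "x \<noteq> y"
  obtains q where "q \<in> Q" "0 < q (x - y)"
proof -
  obtain U where U: "open U" "y \<in> U" "x \<notin> U"
    using t1_space [OF assms [symmetric]] by blast
  then obtain F e where "finite F" "F \<subseteq> Q" "e > 0" "{z. \<forall>q\<in>F. q (z - y) < e} \<subseteq> U"
    using U(1) [unfolded open_iff, rule_format, OF U(2)] by blast
  then obtain q where "q \<in> Q" "\<not> q (x - y) < e" using U(3) by blast
  then show ?thesis using \<open>e > 0\<close> by (intro that [of q]) auto
qed

text \<open>The type class does not relate the topology to the vector operations; continuity of
  subtraction comes from the triangle inequality for the seminorms.\<close>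

lemma continuous_on_diff_pair: "continuous_on S (\<lambda>(a, b). a - b :: 'x)"
proof -
  have "open ((\<lambda>(a, b). a - b :: 'x) -` U)" if "open U" for U
  proof (rule open_prod_intro)
    fix p :: "'x \<times> 'x" assume "p \<in> (\<lambda>(a, b). a - b) -` U"
    then obtain a b where p: "p = (a, b)" and ab: "a - b \<in> U" by (cases p) simp
    then obtain F e where F: "finite F" "F \<subseteq> Q" "e > 0" "{z. \<forall>q\<in>F. q (z - (a - b)) < e} \<subseteq> U"
      using \<open>open U\<close> [unfolded open_iff, rule_format, OF ab] by blast
    define V where "V c = (\<Inter>q\<in>F. {z. q (z - c) < e / 2})" for c
    have "open (V c)" for c
      unfolding V_def using F(1,2) by (intro open_INT ballI open_seminorm_ball) auto
    moreover have "c \<in> V c" for c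
    proof -
      have "q (c - c) < e / 2" if "q \<in> F" for q
        using F(3) seminorm_zero [OF seminorm, of q] subsetD [OF F(2) that] by simp
      then show ?thesis unfolding V_def by blast
    qed
    moreover have "V a \<times> V b \<subseteq> (\<lambda>(a, b). a - b) -` U"
    proof clarsimp
      fix a' b' assume V: "a' \<in> V a" "b' \<in> V b"
      have "q (a' - b' - (a - b)) < e" if q: "q \<in> F" for q
      proof -
        have sq: "seminorm q" using q F(2) seminorm by blast
        have "q (a' - b' - (a - b)) = q ((a' - a) - (b' - b))" by (simp add: algebra_simps)
        also have "\<dots> \<le> q ((a' - a) - 0) + q (0 - (b' - b))" by (rule seminorm_triangle [OF sq])
        also have "\<dots> = q (a' - a) + q (b' - b)"
          using seminorm_minus_commute [OF sq, of 0 "b' - b"] by simp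
        also have "\<dots> < e" using V q by (force simp: V_def)
        finally show ?thesis .
      qed
      then show "a' - b' \<in> U" using F(4) by blast
    qed
    ultimately show "\<exists>A B. open A \<and> open B \<and> p \<in> A \<times> B \<and> A \<times> B \<subseteq> (\<lambda>(a, b). a - b) -` U"
      using p by blast
  qed
  then have "continuous_on UNIV (\<lambda>(a, b). a - b :: 'x)"
    by (simp add: continuous_on_open_vimage)
  then show ?thesis by (rule continuous_on_subset) auto
qed

text \<open>The differences \<open>a - b\<close> with \<open>\<bar>f a - f b\<bar> \<ge> e\<close> form a compact set avoiding \<open>0\<close>, whose
  complement is the required neighbourhood.\<close>

lemma uniformly_continuous_compact:
  fixes f :: "'x \<Rightarrow> real"
  assumes K: "compact K" and f: "continuous_on K f" and e: "e > 0"
  obtains V where "open V" "0 \<in> V" "\<forall>a\<in>K. \<forall>b\<in>K. a - b \<in> V \<longrightarrow> \<bar>f a - f b\<bar> < e"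
proof
  define N where "N = {p \<in> K \<times> K. e \<le> \<bar>f (fst p) - f (snd p)\<bar>}"
  have "continuous_on (K \<times> K) (\<lambda>p. \<bar>f (fst p) - f (snd p)\<bar>)"
    by (intro continuous_intros continuous_on_compose2 [OF f]) auto
  then have "closedin (top_of_set (K \<times> K)) ((K \<times> K) \<inter> (\<lambda>p. \<bar>f (fst p) - f (snd p)\<bar>) -` {e..})"
    by (rule continuous_closedin_preimage) auto
  moreover have "(K \<times> K) \<inter> (\<lambda>p. \<bar>f (fst p) - f (snd p)\<bar>) -` {e..} = N"
    by (auto simp: N_def)
  ultimately have "compact N"
    using K by (metis closedin_compact compact_Times)
  then have "compact ((\<lambda>(a, b). a - b) ` N)"
    by (intro compact_continuous_image continuous_on_diff_pair)
  then show "open (- ((\<lambda>(a, b). a - b) ` N))"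
    by (simp add: compact_imp_closed open_Compl)
  show "0 \<in> - ((\<lambda>(a, b). a - b) ` N)" using e by (auto simp: N_def)
  show "\<forall>a\<in>K. \<forall>b\<in>K. a - b \<in> - ((\<lambda>(a, b). a - b) ` N) \<longrightarrow> \<bar>f a - f b\<bar> < e"
    by (force simp: N_def not_le)
qed

end

subsection \<open>Orbit functions and the enveloping semigroup\<close>

definition orbit_fun ::
  "('s::semitopological_semigroup \<Rightarrow> 'x \<Rightarrow> 'x) \<Rightarrow> 'x \<Rightarrow> ('x \<Rightarrow> real) \<Rightarrow> ('s \<Rightarrow>\<^sub>C real)" where
  "orbit_fun act x f = Bcontfun (\<lambda>t. f (act t x))"

text \<open>The Ellis enveloping semigroup as a topological space, compact by Tychonoff's theorem if
  K is compact. \<open>restrict\<close> places the maps among the extensional functions that form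
  the product.\<close>

definition enveloping_topology :: "'x::topological_space set \<Rightarrow> ('s \<Rightarrow> 'x \<Rightarrow> 'x) \<Rightarrow> ('x \<Rightarrow> 'x) topology" where
  "enveloping_topology K act = subtopology (product_topology (\<lambda>_. top_of_set K) K)
    (product_topology (\<lambda>_. top_of_set K) K closure_of range (\<lambda>s. restrict (act s) K))"

lemma jointly_imp_separately_continuous_action:
  assumes "jointly_continuous_action K act"
  shows "separately_continuous_action K act"
proof -
  have c: "continuous_on (UNIV \<times> K) (\<lambda>p. act (fst p) (snd p))"
    using assms by (simp add: jointly_continuous_action_def case_prod_beta')
  have "continuous_on K (\<lambda>x. act s x)" for s
  proof -
    have "continuous_on K (\<lambda>x. (s, x))" by (intro continuous_intros)
    from continuous_on_compose2 [OF c this] show ?thesis by auto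
  qed
  moreover have "continuous_on UNIV (\<lambda>s. act s x)" if "x \<in> K" for x
  proof -
    have "continuous_on UNIV (\<lambda>s. (s, x))" by (intro continuous_intros)
    from continuous_on_compose2 [OF c this] that show ?thesis by auto
  qed
  ultimately show ?thesis by (auto simp: separately_continuous_action_def)
qed

text \<open>Point evaluations are bounded functionals and separate functions. This makes weakly
  compact sets weakly closed.\<close>

lemma Hausdorff_weak_topology_bcontfun:
  "Hausdorff_space (weak_topology :: ('s::topological_space \<Rightarrow>\<^sub>C real) topology)"
  unfolding Hausdorff_space_def
proof (intro allI impI)
  fix F G :: "'s \<Rightarrow>\<^sub>C real"
  assume "F \<in> topspace weak_topology \<and> G \<in> topspace weak_topology \<and> F \<noteq> G"
  then obtain t where "F t \<noteq> G t" by (meson bcontfun_eqI)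
  then obtain U V where UV: "open U" "open V" "F t \<in> U" "G t \<in> V" "U \<inter> V = {}"
    using hausdorff by metis
  have "bounded_linear (\<lambda>F :: 's \<Rightarrow>\<^sub>C real. F t)"
    by (rule bounded_linear_intro [where K = 1])
      (simp_all add: norm_bounded del: real_norm_def)
  then have "openin weak_topology ((\<lambda>F :: 's \<Rightarrow>\<^sub>C real. F t) -` W)" if "open W" for W
    unfolding weak_topology_def using that by (intro topology_generated_by_Basis) blast
  then show "\<exists>U V. openin weak_topology U \<and> openin weak_topology V \<and> F \<in> U \<and> G \<in> V \<and> disjnt U V"
    using UV by (intro exI [of _ "(\<lambda>F. apply_bcontfun F t) -` U"]
        exI [of _ "(\<lambda>F. apply_bcontfun F t) -` V"]) (auto simp: disjnt_def)
qed

locale compact_action =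
  fixes K :: "'x::t2_space set" and act :: "'s::semitopological_semigroup \<Rightarrow> 'x \<Rightarrow> 'x"
  assumes compact: "compact K" and action: "action_on K act"
    and separately_continuous: "separately_continuous_action K act"
begin

lemma act_in [simp]: "x \<in> K \<Longrightarrow> act s x \<in> K"
  using action by (simp add: action_on_def)

lemma act_mult: "x \<in> K \<Longrightarrow> act (s * t) x = act s (act t x)"
  using action by (simp add: action_on_def)

lemma continuous_on_act: "continuous_on K (act s)"
  using separately_continuous by (simp add: separately_continuous_action_def)

lemma continuous_on_orbit: "x \<in> K \<Longrightarrow> continuous_on UNIV (\<lambda>s. act s x)"
  using separately_continuous by (simp add: separately_continuous_action_def)

lemma continuous_on_compose_act: "continuous_on K f \<Longrightarrow> continuous_on K (\<lambda>y. f (act s y))"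
  by (rule continuous_on_compose2 [OF _ continuous_on_act]) auto

lemma bounded_on_compact:
  fixes f :: "'x \<Rightarrow> real"
  assumes "continuous_on K f"
  obtains M where "\<And>y. y \<in> K \<Longrightarrow> \<bar>f y\<bar> \<le> M"
  using compact_continuous_image [OF assms compact] compact_imp_bounded
  by (force simp: bounded_iff)

lemma apply_orbit_fun:
  assumes "continuous_on K f" "x \<in> K"
  shows "apply_bcontfun (orbit_fun act x f) t = f (act t x)"
proof -
  have "continuous_on UNIV (\<lambda>t. f (act t x))"
    by (rule continuous_on_compose2 [OF assms(1) continuous_on_orbit]) (use assms in auto)
  moreover have "bounded (range (\<lambda>t. f (act t x)))"
    by (rule bounded_subset [OF compact_imp_bounded [OF compact_continuous_image [OF assms(1) compact]]])
      (use assms in auto)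
  ultimately show ?thesis
    by (simp add: orbit_fun_def Bcontfun_inverse bcontfun_def)
qed

text \<open>By (st).x = s.(t.x). This is how invariance of a mean becomes invariance of a functional
  on C(K).\<close>

lemma left_translate_orbit_fun:
  assumes "continuous_on K f" "x \<in> K"
  shows "left_translate s (orbit_fun act x f) = orbit_fun act x (\<lambda>y. f (act s y))"
  by (rule bcontfun_eqI)
    (use assms in \<open>simp add: apply_orbit_fun continuous_on_compose_act act_mult\<close>)

text \<open>By the tube lemma, f (s.y) is close to f (s0.y) uniformly in y \<in> K once s is close
  to s0, and all points t.x lie in K.\<close>

lemma orbit_fun_LUC:
  assumes joint: "jointly_continuous_action K act" and f: "continuous_on K f" and x: "x \<in> K"
  shows "orbit_fun act x f \<in> LUC"
proof -
  have "((\<lambda>s. left_translate s (orbit_fun act x f)) \<longlongrightarrow> left_translate s0 (orbit_fun act x f)) (at s0)" for s0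
  proof (rule tendstoI)
    fix e :: real assume e: "e > 0"
    have c: "continuous_on (UNIV \<times> K) (\<lambda>p. act (fst p) (snd p))"
      using joint by (simp add: jointly_continuous_action_def case_prod_beta')
    have "continuous_on (UNIV \<times> K) (\<lambda>p. f (act (fst p) (snd p)) - f (act s0 (snd p)))"
      by (intro continuous_intros continuous_on_compose2 [OF f c]
          continuous_on_compose2 [OF continuous_on_compose_act [OF f]]) auto
    then obtain W where W: "open W"
      "W \<inter> (UNIV \<times> K) = (\<lambda>p. f (act (fst p) (snd p)) - f (act s0 (snd p))) -` ball 0 (e / 2) \<inter> (UNIV \<times> K)"
      using open_ball unfolding continuous_on_open_invariant by meson
    have "{s0} \<times> K \<subseteq> W" using W(2) e by auto
    from Elementary_Topology.tube_lemma [OF compact W(1) this] obtain U where U: "s0 \<in> U" "open U" "U \<times> K \<subseteq> W" by blast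
    have "dist (left_translate s (orbit_fun act x f)) (left_translate s0 (orbit_fun act x f)) < e"
      if "s \<in> U" for s
    proof -
      have "\<bar>f (act s y) - f (act s0 y)\<bar> < e / 2" if y: "y \<in> K" for y
      proof -
        have "(s, y) \<in> W \<inter> (UNIV \<times> K)" using U(3) \<open>s \<in> U\<close> y by auto
        then show ?thesis unfolding W(2) by simp
      qed
      then have "dist (left_translate s (orbit_fun act x f)) (left_translate s0 (orbit_fun act x f)) \<le> e / 2"
        using f x by (intro dist_bound)
          (simp add: apply_orbit_fun dist_real_def act_mult less_imp_le)
      then show ?thesis using e by simp
    qed
    then show "\<forall>\<^sub>F s in at s0. dist (left_translate s (orbit_fun act x f)) (left_translate s0 (orbit_fun act x f)) < e"
      unfolding eventually_at_topological using U by blast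
  qed
  then show ?thesis
    by (simp add: LUC_def continuous_at_imp_continuous_on isCont_def)
qed

abbreviation "\<E> \<equiv> enveloping_topology K act"

lemma compact_space_enveloping: "compact_space \<E>"
proof -
  have "compact_space (product_topology (\<lambda>_. top_of_set K) K)"
    using compact by (simp add: compact_space_product_topology compact_space_subtopology)
  then show ?thesis
    unfolding enveloping_topology_def
    by (intro compact_space_subtopology closedin_compact_space closedin_closure_of)
qed

lemma topspace_enveloping:
  "topspace \<E> = product_topology (\<lambda>_. top_of_set K) K closure_of range (\<lambda>s. restrict (act s) K)"
  unfolding enveloping_topology_def topspace_subtopology
  by (rule Int_absorb1 [OF closure_of_subset_topspace])

lemma restrict_act_enveloping: "restrict (act s) K \<in> topspace \<E>"
proof -
  have "range (\<lambda>s. restrict (act s) K) \<subseteq> topspace (product_topology (\<lambda>_. top_of_set K) K)"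
    by auto
  then show ?thesis
    unfolding topspace_enveloping using closure_of_subset by blast
qed

lemma enveloping_in: "T \<in> topspace \<E> \<Longrightarrow> y \<in> K \<Longrightarrow> T y \<in> K"
  unfolding enveloping_topology_def by (auto simp: PiE_iff)

lemma continuous_map_enveloping_eval:
  fixes f :: "'x \<Rightarrow> real"
  assumes "continuous_on K f" "y \<in> K"
  shows "continuous_map \<E> euclideanreal (\<lambda>T. f (T y))"
proof -
  have "continuous_map \<E> (top_of_set K) (\<lambda>T. T y)"
    unfolding enveloping_topology_def
    by (intro continuous_map_from_subtopology continuous_map_product_projection assms)
  then show ?thesis
    using continuous_map_compose [of \<E> "top_of_set K" "\<lambda>T. T y" euclideanreal f] assms
    by (simp add: o_def)
qed

text \<open>The action maps are dense in \<open>\<E>\<close>; estimates for them carry over to their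
  pointwise limits in this way.\<close>

lemma enveloping_closed_condition:
  assumes "closedin \<E> C" "\<And>s. restrict (act s) K \<in> C"
  shows "topspace \<E> \<subseteq> C"
proof -
  have "closedin (product_topology (\<lambda>_. top_of_set K) K) C"
    using assms(1) unfolding enveloping_topology_def
    by (meson closedin_closed_subtopology closedin_closure_of)
  then show ?thesis
    unfolding topspace_enveloping by (intro closure_of_minimal) (use assms(2) in auto)
qed

text \<open>Reduces relative compactness of the translates to continuity of a map on the compact
  space \<open>\<E>\<close>.\<close>

lemma range_left_translate_subset:
  assumes "continuous_on K f" "x \<in> K"
  shows "range (\<lambda>s. left_translate s (orbit_fun act x f)) \<subseteq> (\<lambda>T. orbit_fun act x (\<lambda>y. f (T y))) ` topspace \<E>"
proof clarify
  fix s
  have "left_translate s (orbit_fun act x f) = orbit_fun act x (\<lambda>y. f (restrict (act s) K y))"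
    unfolding left_translate_orbit_fun [OF assms] using assms by (simp add: orbit_fun_def)
  then show "left_translate s (orbit_fun act x f) \<in> (\<lambda>T. orbit_fun act x (\<lambda>y. f (T y))) ` topspace \<E>"
    by (rule image_eqI [where x = "restrict (act s) K"]) (rule restrict_act_enveloping)
qed

text \<open>The value f (T y) is continuous in T by the product topology and in y by
  quasi-equicontinuity, so \<open>weakly_continuous_of_separately_continuous\<close> applies to
  every functional. The image of \<open>\<E>\<close> is weakly compact, hence weakly closed, and
  contains the translates.\<close>

lemma orbit_fun_WAP:
  assumes quasi: "quasi_equicontinuous_action K act" and f: "continuous_on K f" and x: "x \<in> K"
  shows "orbit_fun act x f \<in> WAP"
proof -
  let ?F = "\<lambda>T. orbit_fun act x (\<lambda>y. f (T y))"
  obtain M where M: "\<And>y. y \<in> K \<Longrightarrow> \<bar>f y\<bar> \<le> M" using bounded_on_compact [OF f] by blast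
  have fT: "continuous_on K (\<lambda>y. f (T y))" if "T \<in> topspace \<E>" for T
  proof (rule continuous_on_compose2 [OF f])
    show "continuous_on K T"
      using quasi that unfolding quasi_equicontinuous_action_def topspace_enveloping by blast
  qed (use enveloping_in that in auto)
  have "continuous_map \<E> weak_topology ?F"
    unfolding weak_topology_def
  proof (rule continuous_on_generated_topo)
    fix W assume "W \<in> {\<phi> -` U |(\<phi> :: ('s \<Rightarrow>\<^sub>C real) \<Rightarrow> real) U. bounded_linear \<phi> \<and> open U}"
    then obtain \<phi> :: "('s \<Rightarrow>\<^sub>C real) \<Rightarrow> real" and U
      where W: "W = \<phi> -` U" and \<phi>: "bounded_linear \<phi>" and U: "open U" by blast
    have "continuous_map \<E> euclideanreal (\<lambda>T. \<phi> (?F T))"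
    proof (rule weakly_continuous_of_separately_continuous [OF \<phi> compact_space_enveloping compact])
      show "continuous_on UNIV (\<lambda>t. act t x)" by (rule continuous_on_orbit [OF x])
      show "act t x \<in> K" for t by (rule act_in [OF x])
      show "continuous_map \<E> euclideanreal (\<lambda>T. f (T y))" if "y \<in> K" for y
        by (rule continuous_map_enveloping_eval [OF f that])
      show "\<bar>f (T y)\<bar> \<le> M" if "T \<in> topspace \<E>" "y \<in> K" for T y
        by (rule M [OF enveloping_in [OF that]])
      show "apply_bcontfun (?F T) t = f (T (act t x))" if "T \<in> topspace \<E>" for T t
        by (rule apply_orbit_fun [OF fT [OF that] x])
    qed (rule fT)
    then have "openin \<E> {T \<in> topspace \<E>. \<phi> (?F T) \<in> U}"
      by (rule openin_continuous_map_preimage) (use U in auto)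
    moreover have "{T \<in> topspace \<E>. \<phi> (?F T) \<in> U} = ?F -` W \<inter> topspace \<E>"
      by (auto simp: W)
    ultimately show "openin \<E> (?F -` W \<inter> topspace \<E>)" by simp
  next
    have "UNIV \<in> {\<phi> -` U |(\<phi> :: ('s \<Rightarrow>\<^sub>C real) \<Rightarrow> real) U. bounded_linear \<phi> \<and> open U}"
      by (intro CollectI exI [of _ "\<lambda>_. 0"] exI [of _ UNIV]) (auto simp: bounded_linear_zero)
    then show "?F ` topspace \<E> \<subseteq> \<Union> {\<phi> -` U |(\<phi> :: ('s \<Rightarrow>\<^sub>C real) \<Rightarrow> real) U. bounded_linear \<phi> \<and> open U}"
      by blast
  qed
  then have C: "compactin weak_topology (?F ` topspace \<E>)"
    using compact_space_enveloping by (meson compact_space_def image_compactin)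
  then have "weak_topology closure_of range (\<lambda>s. left_translate s (orbit_fun act x f)) \<subseteq> ?F ` topspace \<E>"
    by (intro closure_of_minimal range_left_translate_subset f x
        compactin_imp_closedin Hausdorff_weak_topology_bcontfun)
  then show ?thesis
    unfolding WAP_def using closed_compactin [OF C] closedin_closure_of by blast
qed

end

text \<open>Ascoli's argument: equicontinuity of the functions f (s.y) extends to all f (T y) with T
  in \<open>\<E>\<close>, and on an equicontinuous family pointwise convergence is uniform on
  K.\<close>

lemma (in lcs) orbit_fun_AP:
  fixes K :: "'x set" and act :: "'s::semitopological_semigroup \<Rightarrow> 'x \<Rightarrow> 'x"
  assumes "compact_action K act"
    and equi: "equicontinuous_action K act" and f: "continuous_on K f" and x: "x \<in> K"
  shows "orbit_fun act x f \<in> AP"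
proof -
  interpret compact_action K act by fact
  let ?F = "\<lambda>T. orbit_fun act x (\<lambda>y. f (T y))"
  have equi': "\<exists>U. open U \<and> z \<in> U \<and> (\<forall>y\<in>U \<inter> K. \<forall>T\<in>topspace \<E>. \<bar>f (T y) - f (T z)\<bar> \<le> e)"
    if z: "z \<in> K" and e: "e > 0" for z e
  proof -
    obtain V where V: "open V" "0 \<in> V" "\<forall>a\<in>K. \<forall>b\<in>K. a - b \<in> V \<longrightarrow> \<bar>f a - f b\<bar> < e"
      by (rule uniformly_continuous_compact [OF compact f e])
    obtain U where U: "open U" "z \<in> U" "\<And>y s. y \<in> U \<inter> K \<Longrightarrow> act s y - act s z \<in> V"
      using equi z V(1,2) unfolding equicontinuous_action_def by meson
    have "\<bar>f (T y) - f (T z)\<bar> \<le> e" if y: "y \<in> U \<inter> K" and T: "T \<in> topspace \<E>" for y T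
    proof -
      have "continuous_map \<E> euclideanreal (\<lambda>T. \<bar>f (T y) - f (T z)\<bar>)"
        using y z by (intro continuous_map_real_abs continuous_map_diff continuous_map_enveloping_eval f) auto
      then have "closedin \<E> {T \<in> topspace \<E>. \<bar>f (T y) - f (T z)\<bar> \<in> {..e}}"
        by (rule closedin_continuous_map_preimage) auto
      then have "topspace \<E> \<subseteq> {T \<in> topspace \<E>. \<bar>f (T y) - f (T z)\<bar> \<in> {..e}}"
      proof (rule enveloping_closed_condition)
        show "restrict (act s) K \<in> {T \<in> topspace \<E>. \<bar>f (T y) - f (T z)\<bar> \<in> {..e}}" for s
          using restrict_act_enveloping y z U(3) V(3) by (auto intro: less_imp_le)
      qed
      then show ?thesis using T by blast
    qed
    with U show ?thesis by blast
  qed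
  have fT: "continuous_on K (\<lambda>y. f (T y))" if T: "T \<in> topspace \<E>" for T
    unfolding continuous_on_def
  proof (intro ballI tendstoI)
    fix z and e :: real assume "z \<in> K" "e > 0"
    with equi' [of z "e / 2"] obtain U where U: "open U" "z \<in> U"
      "\<And>y. y \<in> U \<inter> K \<Longrightarrow> \<bar>f (T y) - f (T z)\<bar> \<le> e / 2" using T by auto
    have "dist (f (T y)) (f (T z)) < e" if "y \<in> U" "y \<in> K" for y
      using U(3) [of y] that \<open>e > 0\<close> by (simp add: dist_real_def)
    with U(1,2) show "\<forall>\<^sub>F y in at z within K. dist (f (T y)) (f (T z)) < e"
      unfolding eventually_at_topological by blast
  qed
  have "continuous_map \<E> euclidean ?F"
  proof (rule continuous_map_metricI)
    fix T0 and e :: real assume T0: "T0 \<in> topspace \<E>" and e: "e > 0"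
    have "\<forall>z. \<exists>U. z \<in> K \<longrightarrow> open U \<and> z \<in> U \<and> (\<forall>y\<in>U \<inter> K. \<forall>T\<in>topspace \<E>. \<bar>f (T y) - f (T z)\<bar> \<le> e / 4)"
      using equi' [where e = "e / 4"] e by auto
    from choice [OF this] obtain U where U: "\<And>z. z \<in> K \<Longrightarrow> open (U z)" "\<And>z. z \<in> K \<Longrightarrow> z \<in> U z"
      "\<And>z y T. z \<in> K \<Longrightarrow> y \<in> U z \<Longrightarrow> y \<in> K \<Longrightarrow> T \<in> topspace \<E> \<Longrightarrow> \<bar>f (T y) - f (T z)\<bar> \<le> e / 4"
      by blast
    have "K \<subseteq> (\<Union>z\<in>K. U z)" using U(2) by auto
    from compactE_image [OF compact U(1) this] obtain Y
      where Y: "Y \<subseteq> K" "finite Y" "K \<subseteq> (\<Union>z\<in>Y. U z)" by auto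
    then have "Y \<noteq> {}" using x by auto
    \<comment> \<open>\<open>N\<close> controls T at finitely many points; moving from y to one of
      them costs e / 4 under T and e / 4 under T0, in total 3 * e / 4.\<close>
    define N where "N = (\<Inter>z\<in>Y. {T \<in> topspace \<E>. f (T z) \<in> ball (f (T0 z)) (e / 4)})"
    have "openin \<E> N"
      unfolding N_def
      by (intro openin_INT2 Y(2) \<open>Y \<noteq> {}\<close> openin_continuous_map_preimage [OF continuous_map_enveloping_eval [OF f]])
        (use Y(1) in auto)
    moreover have "T0 \<in> N" using T0 e by (auto simp: N_def)
    moreover have "dist (?F T) (?F T0) < e" if T: "T \<in> N" for T
    proof -
      have TE: "T \<in> topspace \<E>" using T \<open>Y \<noteq> {}\<close> by (auto simp: N_def)
      have "\<bar>f (T y) - f (T0 y)\<bar> \<le> 3 * e / 4" if y: "y \<in> K" for y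
      proof -
        obtain z where z: "z \<in> Y" "y \<in> U z" using Y(3) y by auto
        have "\<bar>f (T z) - f (T0 z)\<bar> < e / 4"
          using T z(1) by (auto simp: N_def dist_real_def abs_minus_commute)
        moreover have "\<bar>f (T y) - f (T z)\<bar> \<le> e / 4" "\<bar>f (T0 y) - f (T0 z)\<bar> \<le> e / 4"
          using U(3) z Y(1) y TE T0 by blast+
        ultimately show ?thesis by linarith
      qed
      then have "dist (?F T) (?F T0) \<le> 3 * e / 4"
        using x by (intro dist_bound) (simp add: apply_orbit_fun fT TE T0 dist_real_def)
      then show ?thesis using e by simp
    qed
    ultimately show "\<exists>U. openin \<E> U \<and> T0 \<in> U \<and> (\<forall>T\<in>U. dist (?F T) (?F T0) < e)" by blast
  qed
  then have "compactin euclidean (?F ` topspace \<E>)"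
    using compact_space_enveloping by (meson compact_space_def image_compactin)
  then have "compact (?F ` topspace \<E>)" by simp
  moreover have sub: "closure (range (\<lambda>s. left_translate s (orbit_fun act x f))) \<subseteq> ?F ` topspace \<E>"
    by (intro closure_minimal range_left_translate_subset f x compact_imp_closed calculation)
  ultimately have "compact (?F ` topspace \<E> \<inter> closure (range (\<lambda>s. left_translate s (orbit_fun act x f))))"
    by (intro compact_Int_closed) auto
  then show ?thesis
    unfolding AP_def using sub by (simp add: Int_absorb1)
qed

subsection \<open>Invariant sets\<close>

lemma Urysohn_compact:
  fixes K :: "'x::t2_space set"
  assumes K: "compact K" and C: "compact C" "C \<subseteq> K" and z: "z \<in> K" "z \<notin> C"
  obtains f :: "'x \<Rightarrow> real" where "continuous_on K f" "\<forall>y\<in>K. 0 \<le> f y" "f z = 1"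
    "\<forall>y\<in>C. f y = 0"
proof -
  have "Hausdorff_space (euclidean :: 'x topology)"
    unfolding Hausdorff_space_def disjnt_def using hausdorff by simp blast
  then have "normal_space (top_of_set K)"
    using K by (intro compact_Hausdorff_or_regular_imp_normal_space)
      (simp_all add: compact_space_subtopology Hausdorff_space_subtopology)
  moreover have "closedin (top_of_set K) C" "closedin (top_of_set K) {z}"
    using C z by (auto intro!: closed_subset compact_imp_closed)
  moreover have "disjnt C {z}" using z by (simp add: disjnt_def)
  ultimately obtain f :: "'x \<Rightarrow> real"
    where f: "continuous_map (top_of_set K) (top_of_set {0..1}) f" "f ` C \<subseteq> {0}" "f ` {z} \<subseteq> {1}"
    using Urysohn_lemma [of "top_of_set K" C "{z}" 0 1] by (metis zero_le_one)
  then have "continuous_on K f" "f \<in> K \<rightarrow> {0..1}"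
    by (auto simp: continuous_map_in_subtopology)
  with f show ?thesis by (intro that [of f]) auto
qed

context compact_action
begin

text \<open>The common zeros of the nonnegative functions with \<Phi> f = 0 form the support of the
  measure representing \<Phi>, described without that measure. Urysohn functions then exclude points
  outside C and outside the image of F.\<close>

lemma invariant_support:
  fixes \<Phi> :: "('x \<Rightarrow> real) \<Rightarrow> real"
  assumes add: "\<And>f g. continuous_on K f \<Longrightarrow> continuous_on K g \<Longrightarrow> \<Phi> (\<lambda>y. f y + g y) = \<Phi> f + \<Phi> g"
    and scale: "\<And>f c. continuous_on K f \<Longrightarrow> \<Phi> (\<lambda>y. c * f y) = c * \<Phi> f"
    and const: "\<And>c. \<Phi> (\<lambda>_. c) = c"
    and nonneg: "\<And>f. continuous_on K f \<Longrightarrow> (\<And>y. y \<in> K \<Longrightarrow> 0 \<le> f y) \<Longrightarrow> 0 \<le> \<Phi> f"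
    and invariant: "\<And>f s. continuous_on K f \<Longrightarrow> \<Phi> (\<lambda>y. f (act s y)) = \<Phi> f"
    and C: "compact C" "C \<subseteq> K"
    and zero: "\<And>f. continuous_on K f \<Longrightarrow> (\<And>y. y \<in> C \<Longrightarrow> f y = 0) \<Longrightarrow> \<Phi> f = 0"
  shows "\<exists>F. compact F \<and> F \<noteq> {} \<and> F \<subseteq> C \<and> (\<forall>s. act s ` F = F)"
proof -
  define Z where "Z = {f. continuous_on K f \<and> (\<forall>y\<in>K. 0 \<le> f y) \<and> \<Phi> f = 0}"
  define F where "F = {z \<in> K. \<forall>f\<in>Z. f z = 0}"
  have mono: "\<Phi> f \<le> \<Phi> g" if "continuous_on K f" "continuous_on K g" "\<And>y. y \<in> K \<Longrightarrow> f y \<le> g y" for f g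
  proof -
    have "\<Phi> (\<lambda>y. f y + (g y - f y)) = \<Phi> f + \<Phi> (\<lambda>y. g y - f y)"
      by (intro add continuous_on_diff that)
    moreover have "0 \<le> \<Phi> (\<lambda>y. g y - f y)"
      by (intro nonneg continuous_on_diff) (use that in auto)
    ultimately show ?thesis by simp
  qed
  have sumZ: "(\<lambda>y. \<Sum>i\<in>I. h i y) \<in> Z" if "finite I" "\<And>i. i \<in> I \<Longrightarrow> h i \<in> Z" for I :: "'x set" and h
    using that
  proof (induction I)
    case empty
    then show ?case using const [of 0] by (simp add: Z_def)
  next
    case (insert i I)
    then have "(\<lambda>y. \<Sum>i\<in>I. h i y) \<in> Z" "h i \<in> Z" by auto
    then have "\<Phi> (\<lambda>y. h i y + (\<Sum>i\<in>I. h i y)) = 0"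
      by (subst add) (auto simp: Z_def)
    with insert show ?case by (auto simp: Z_def intro!: continuous_intros sum_nonneg)
  qed
  \<comment> \<open>The set where g \<ge> e misses F, so finitely many null functions add up to a
    null h with h \<ge> 1 there. Then g \<le> e + |M| h on K, and e is arbitrary.\<close>
  have vanish: "\<Phi> g = 0" if g: "continuous_on K g" "\<And>y. y \<in> K \<Longrightarrow> 0 \<le> g y" "\<And>y. y \<in> F \<Longrightarrow> g y = 0" for g
  proof -
    obtain M where M: "\<And>y. y \<in> K \<Longrightarrow> \<bar>g y\<bar> \<le> M" using bounded_on_compact [OF g(1)] by blast
    have "\<Phi> g \<le> e" if e: "e > 0" for e
    proof -
      define N where "N = K \<inter> g -` {e..}"
      have "closedin (top_of_set K) N"
        unfolding N_def by (rule continuous_closedin_preimage [OF g(1)]) simp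
      then have N: "compact N" using compact closedin_compact by blast
      have "\<forall>z. \<exists>U f. z \<in> N \<longrightarrow> open U \<and> z \<in> U \<and> f \<in> Z \<and> (\<forall>y\<in>U \<inter> K. 1 < f y)"
      proof
        fix z
        show "\<exists>U f. z \<in> N \<longrightarrow> open U \<and> z \<in> U \<and> f \<in> Z \<and> (\<forall>y\<in>U \<inter> K. 1 < f y)"
        proof (cases "z \<in> N")
          case True
          then have z: "z \<in> K" "z \<notin> F" using g(3) e by (auto simp: N_def)
          then obtain f where f: "f \<in> Z" "f z \<noteq> 0" by (auto simp: F_def)
          have fz: "f z > 0" using f z(1) by (auto simp: Z_def less_le)
          \<comment> \<open>Normalised to the value 2 at z, so that it exceeds 1 nearby.\<close>
          define f' where "f' = (\<lambda>y. (2 / f z) * f y)"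
          have "f' \<in> Z"
            using f(1) fz scale [of f "2 / f z"] by (auto simp: Z_def f'_def intro!: continuous_intros)
          then have "continuous_on K f'" by (simp add: Z_def)
          then obtain U where U: "open U" "U \<inter> K = f' -` {1<..} \<inter> K"
            using open_greaterThan [of "1::real"] unfolding continuous_on_open_invariant by meson
          have "z \<in> f' -` {1<..} \<inter> K" using fz z(1) by (simp add: f'_def)
          then have "z \<in> U" using U(2) by auto
          moreover have "1 < f' y" if "y \<in> U \<inter> K" for y using U(2) that by auto
          ultimately show ?thesis using U(1) \<open>f' \<in> Z\<close> by blast
        qed auto
      qed
      then obtain U f where U: "\<And>z. z \<in> N \<Longrightarrow> open (U z)" "\<And>z. z \<in> N \<Longrightarrow> z \<in> U z"
        and f: "\<And>z. z \<in> N \<Longrightarrow> f z \<in> Z" "\<And>z y. z \<in> N \<Longrightarrow> y \<in> U z \<Longrightarrow> y \<in> K \<Longrightarrow> 1 < f z y"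
        unfolding choice_iff by auto
      have "N \<subseteq> (\<Union>z\<in>N. U z)" using U(2) by auto
      from compactE_image [OF N U(1) this] obtain Y
        where Y: "Y \<subseteq> N" "finite Y" "N \<subseteq> (\<Union>z\<in>Y. U z)" by auto
      define h where "h y = (\<Sum>z\<in>Y. f z y)" for y
      have h: "h \<in> Z" unfolding h_def [abs_def] using sumZ [of Y f] Y f(1) by auto
      have h1: "1 \<le> h y" if y: "y \<in> N" for y
      proof -
        obtain z where z: "z \<in> Y" "y \<in> U z" using Y(3) y by auto
        have yK: "y \<in> K" using y by (simp add: N_def)
        have "1 \<le> f z y" using f(2) [of z y] z Y(1) yK by auto
        also have "\<dots> \<le> h y" unfolding h_def
          by (rule member_le_sum [OF z(1)]) (use f(1) Y yK in \<open>auto simp: Z_def\<close>)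
        finally show ?thesis .
      qed
      have "g y \<le> e + \<bar>M\<bar> * h y" if y: "y \<in> K" for y
      proof (cases "y \<in> N")
        case True
        have "g y \<le> \<bar>M\<bar> * 1" using M [OF y] by simp
        also have "\<dots> \<le> \<bar>M\<bar> * h y" using h1 [OF True] by (intro mult_left_mono) auto
        finally show ?thesis using e by simp
      next
        case False
        then have "g y < e" using y by (simp add: N_def)
        moreover have "0 \<le> \<bar>M\<bar> * h y" using h y by (simp add: Z_def)
        ultimately show ?thesis by simp
      qed
      then have "\<Phi> g \<le> \<Phi> (\<lambda>y. e + \<bar>M\<bar> * h y)"
        using h by (intro mono g) (auto simp: Z_def intro!: continuous_intros)
      also have "\<dots> = \<Phi> (\<lambda>_. e) + \<Phi> (\<lambda>y. \<bar>M\<bar> * h y)"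
        using h by (intro add) (auto simp: Z_def intro!: continuous_intros)
      also have "\<dots> = e" using h scale [of h] const by (simp add: Z_def)
      finally show ?thesis .
    qed
    then have "\<Phi> g \<le> 0" by (rule field_le_epsilon [where y = 0, simplified])
    with nonneg [OF g(1,2)] show ?thesis by simp
  qed
  have "closedin (top_of_set K) {y \<in> K. f y = 0}" if "f \<in> Z" for f
    using continuous_closedin_preimage_constant [of K f 0] that by (simp add: Z_def)
  moreover have zeroZ: "(\<lambda>_. 0) \<in> Z" using const [of 0] by (simp add: Z_def)
  ultimately have "closedin (top_of_set K) (\<Inter>f\<in>Z. {y \<in> K. f y = 0})"
    by (intro closedin_INT) auto
  also have "(\<Inter>f\<in>Z. {y \<in> K. f y = 0}) = F" using zeroZ by (auto simp: F_def)
  finally have F: "compact F" using compact closedin_compact by blast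
  have FK: "F \<subseteq> K" by (auto simp: F_def)
  \<comment> \<open>For empty F the constant 1 would be annihilated by \<Phi>.\<close>
  have "F \<noteq> {}"
    using vanish [of "\<lambda>_. 1"] const [of 1] by auto
  moreover have "F \<subseteq> C"
  proof
    fix z assume z: "z \<in> F"
    show "z \<in> C"
    proof (rule ccontr)
      assume "z \<notin> C"
      then obtain f :: "'x \<Rightarrow> real" where f: "continuous_on K f" "\<forall>y\<in>K. 0 \<le> f y" "f z = 1" "\<forall>y\<in>C. f y = 0"
        using Urysohn_compact [OF compact C subsetD [OF FK z]] by blast
      then have "f \<in> Z" using zero by (simp add: Z_def)
      then show False using z f(3) by (auto simp: F_def)
    qed
  qed
  moreover have "act s ` F = F" for s
  proof
    show "act s ` F \<subseteq> F"
    proof clarify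
      fix z assume z: "z \<in> F"
      have "f (act s z) = 0" if "f \<in> Z" for f
      proof -
        have "(\<lambda>y. f (act s y)) \<in> Z"
          using that invariant continuous_on_compose_act by (auto simp: Z_def)
        then show ?thesis using z by (auto simp: F_def)
      qed
      then show "act s z \<in> F" using z by (auto simp: F_def)
    qed
    \<comment> \<open>A function separating z from the image of F becomes zero on F when composed
      with \<open>act s\<close>, hence null; by invariance it is null itself, contrary to z \<in>
      F.\<close>
    show "F \<subseteq> act s ` F"
    proof
      fix z assume z: "z \<in> F"
      have sF: "compact (act s ` F)" "act s ` F \<subseteq> K"
        using F FK continuous_on_subset [OF continuous_on_act FK] by (auto intro: compact_continuous_image)
      show "z \<in> act s ` F"
      proof (rule ccontr)
        assume "z \<notin> act s ` F"
        then obtain f :: "'x \<Rightarrow> real" where f: "continuous_on K f" "\<forall>y\<in>K. 0 \<le> f y" "f z = 1"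
          "\<forall>y\<in>act s ` F. f y = 0"
          using Urysohn_compact [OF compact sF subsetD [OF FK z]] by blast
        have "\<Phi> (\<lambda>y. f (act s y)) = 0"
          by (rule vanish) (use f continuous_on_compose_act in auto)
        then have "f \<in> Z" using f invariant by (simp add: Z_def)
        then show False using z f(3) by (auto simp: F_def)
      qed
    qed
  qed
  ultimately show ?thesis using F by blast
qed

text \<open>Applies \<open>invariant_support\<close> to \<Phi> f = m (t \<mapsto> f (t.x)), with the
  orbit closure as C, because this functional sees f only along the orbit.\<close>

lemma invariant_set_of_mean:
  assumes m: "left_invariant_mean A m" and x: "x \<in> K"
    and A: "\<And>f. continuous_on K f \<Longrightarrow> orbit_fun act x f \<in> A"
  obtains F where "compact F" "F \<noteq> {}" "F \<subseteq> closure (range (\<lambda>s. act s x))" "\<And>s. act s ` F = F"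
proof -
  let ?O = "\<lambda>f. orbit_fun act x f"
  have m_add: "\<And>f g. f \<in> A \<Longrightarrow> g \<in> A \<Longrightarrow> m (f + g) = m f + m g"
    and m_scale: "\<And>f c. f \<in> A \<Longrightarrow> m (c *\<^sub>R f) = c * m f"
    and m_one: "m (const_bcontfun 1) = 1"
    and m_inv: "\<And>f s. f \<in> A \<Longrightarrow> m (left_translate s f) = m f"
    using m by (auto simp: left_invariant_mean_def bounded_functional_on_def)
  have m_le: "m f \<le> norm f" if "f \<in> A" for f
  proof (cases "f = 0")
    case True
    then show ?thesis using m_scale [OF that, of 0] by simp
  next
    case False
    obtain B where B: "\<forall>f\<in>A. \<bar>m f\<bar> \<le> B * norm f"
      using m by (auto simp: left_invariant_mean_def bounded_functional_on_def)
    \<comment> \<open>The supremum in the norm bounds its members only if they are bounded above;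
      the quotient at f = 0 has the default value 0.\<close>
    have "bdd_above ((\<lambda>f. \<bar>m f\<bar> / norm f) ` A)"
    proof (rule bdd_aboveI2)
      fix f assume "f \<in> A"
      with B have "\<bar>m f\<bar> \<le> B * norm f" by blast
      then show "\<bar>m f\<bar> / norm f \<le> \<bar>B\<bar>"
        by (cases "f = 0") (auto simp: divide_simps intro: order_trans mult_right_mono)
    qed
    then have "\<bar>m f\<bar> / norm f \<le> functional_norm_on A m"
      unfolding functional_norm_on_def using that by (intro cSUP_upper)
    then have "\<bar>m f\<bar> / norm f \<le> 1" using m by (simp add: left_invariant_mean_def)
    then show ?thesis using False by (simp add: divide_simps)
  qed
  have const: "m (?O (\<lambda>_. c)) = c" for c
  proof -
    have "?O (\<lambda>_. c) = c *\<^sub>R ?O (\<lambda>_. 1)"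
      by (rule bcontfun_eqI) (use x in \<open>simp add: apply_orbit_fun\<close>)
    moreover have "?O (\<lambda>_. 1) = const_bcontfun 1"
      by (rule bcontfun_eqI) (use x in \<open>simp add: apply_orbit_fun const_bcontfun.rep_eq\<close>)
    moreover have "?O (\<lambda>_. 1) \<in> A" by (intro A continuous_on_const)
    ultimately show ?thesis using m_scale m_one by simp
  qed
  have add: "m (?O (\<lambda>y. f y + g y)) = m (?O f) + m (?O g)"
    if "continuous_on K f" "continuous_on K g" for f g
  proof -
    have "?O (\<lambda>y. f y + g y) = ?O f + ?O g"
      by (rule bcontfun_eqI) (use x that in \<open>simp add: apply_orbit_fun continuous_on_add\<close>)
    then show ?thesis using m_add A that by simp
  qed
  have scale: "m (?O (\<lambda>y. c * f y)) = c * m (?O f)" if "continuous_on K f" for f c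
  proof -
    have "?O (\<lambda>y. c * f y) = c *\<^sub>R ?O f"
      by (rule bcontfun_eqI) (use x that in \<open>simp add: apply_orbit_fun continuous_on_mult_left\<close>)
    then show ?thesis using m_scale A that by simp
  qed
  \<comment> \<open>Positivity from norm one: M - f has values in [0, M], so its mean is at most M,
    while the mean of the constant M is M.\<close>
  have nonneg: "0 \<le> m (?O f)" if f: "continuous_on K f" "\<And>y. y \<in> K \<Longrightarrow> 0 \<le> f y" for f
  proof -
    obtain M where M: "\<And>y. y \<in> K \<Longrightarrow> \<bar>f y\<bar> \<le> M" using bounded_on_compact [OF f(1)] by blast
    have c: "continuous_on K (\<lambda>y. (- 1) * f y)" by (intro continuous_intros f)
    have c': "continuous_on K (\<lambda>y. M + (- 1) * f y)" by (intro continuous_intros f)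
    have "m (?O (\<lambda>y. M + (- 1) * f y)) \<le> norm (?O (\<lambda>y. M + (- 1) * f y))"
      by (rule m_le [OF A [OF c']])
    also have "\<dots> \<le> M"
    proof (rule norm_bound)
      show "norm (apply_bcontfun (?O (\<lambda>y. M + (- 1) * f y)) t) \<le> M" for t
        unfolding apply_orbit_fun [OF c' x] using f(2) [of "act t x"] M [of "act t x"] x by simp
    qed
    finally show ?thesis using add [OF continuous_on_const c, of M] const scale [OF f(1), of "- 1"] by simp
  qed
  have invariant: "m (?O (\<lambda>y. f (act s y))) = m (?O f)" if "continuous_on K f" for f s
    using m_inv [OF A [OF that], of s] left_translate_orbit_fun [OF that x] by simp
  let ?C = "closure (range (\<lambda>s. act s x))"
  have C: "?C \<subseteq> K" by (rule closure_minimal) (use x compact in \<open>auto intro: compact_imp_closed\<close>)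
  then have cC: "compact ?C" using compact_Int_closed [OF compact, of ?C] by (simp add: Int_absorb1)
  have zero: "m (?O f) = 0" if "continuous_on K f" "\<And>y. y \<in> ?C \<Longrightarrow> f y = 0" for f
  proof -
    have "f (act t x) = 0" for t by (intro that(2) subsetD [OF closure_subset]) simp
    then have "?O f = ?O (\<lambda>_. 0)" by (simp add: orbit_fun_def)
    then show ?thesis using const by simp
  qed
  have "\<exists>F. compact F \<and> F \<noteq> {} \<and> F \<subseteq> ?C \<and> (\<forall>s. act s ` F = F)"
    by (rule invariant_support [where \<Phi> = "\<lambda>f. m (?O f)"])
      (fact add scale const nonneg invariant cC C zero)+
  then show ?thesis using that by blast
qed

text \<open>The set \<Omega>(x). Under right reversibility the closed left ideals are directed
  downwards, and these are the cluster points of s.x along them.\<close>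

definition limit_set :: "'x \<Rightarrow> 'x set" where
  "limit_set x = (\<Inter>I\<in>{I. left_ideal I \<and> closed I}. closure ((\<lambda>s. act s x) ` I))"

lemma limit_set_subset_closure: "left_ideal I \<Longrightarrow> closed I \<Longrightarrow> limit_set x \<subseteq> closure ((\<lambda>s. act s x) ` I)"
  unfolding limit_set_def by blast

lemma orbit_closure_subset: "x \<in> K \<Longrightarrow> closure ((\<lambda>s. act s x) ` I) \<subseteq> K"
  by (rule closure_minimal) (use compact in \<open>auto intro: compact_imp_closed\<close>)

lemma limit_set_subset: "x \<in> K \<Longrightarrow> limit_set x \<subseteq> K"
  using limit_set_subset_closure [of UNIV x] orbit_closure_subset [of x UNIV]
  by (simp add: left_ideal_def)

lemma closed_limit_set: "closed (limit_set x)"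
  unfolding limit_set_def by auto

text \<open>A left ideal I absorbs s from the left, so \<open>act s\<close> maps I.x into itself
  and, by continuity, also its closure.\<close>

lemma act_limit_set:
  assumes x: "x \<in> K" and z: "z \<in> limit_set x"
  shows "act s z \<in> limit_set x"
  unfolding limit_set_def
proof (rule INT_I)
  fix I :: "'s set" assume I: "I \<in> {I. left_ideal I \<and> closed I}"
  have "act s ` closure ((\<lambda>s. act s x) ` I) \<subseteq> closure ((\<lambda>s. act s x) ` I)"
  proof (rule image_closure_subset)
    show "continuous_on (closure ((\<lambda>s. act s x) ` I)) (act s)"
      by (rule continuous_on_subset [OF continuous_on_act orbit_closure_subset [OF x]])
    have "act s ` (\<lambda>s. act s x) ` I \<subseteq> (\<lambda>s. act s x) ` I"
      using I x by (auto simp: left_ideal_def act_mult [symmetric])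
    then show "act s ` (\<lambda>s. act s x) ` I \<subseteq> closure ((\<lambda>s. act s x) ` I)"
      using closure_subset by blast
  qed auto
  then show "act s z \<in> closure ((\<lambda>s. act s x) ` I)"
    using z I unfolding limit_set_def by blast
qed

text \<open>Right reversibility makes finite intersections of closed left ideals nonempty; the rest
  is compactness of K.\<close>

lemma limit_set_nonempty:
  assumes R: "right_reversible TYPE('s)" and x: "x \<in> K"
  shows "limit_set x \<noteq> {}"
proof -
  have ideal: "left_ideal (\<Inter>\<I>) \<and> closed (\<Inter>\<I>)"
    if "finite \<I>" "\<I> \<subseteq> {I :: 's set. left_ideal I \<and> closed I}" for \<I>
    using that
  proof (induction \<I>)
    case empty
    then show ?case by (simp add: left_ideal_def)
  next
    case (insert I \<I>)
    then have "left_ideal I" "closed I" "left_ideal (\<Inter>\<I>)" "closed (\<Inter>\<I>)" by auto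
    moreover from this have "I \<inter> \<Inter>\<I> \<noteq> {}" using R unfolding right_reversible_def by blast
    ultimately show ?case by (auto simp: left_ideal_def)
  qed
  have "K \<inter> (\<Inter>I\<in>{I. left_ideal I \<and> closed I}. closure ((\<lambda>s. act s x) ` I)) \<noteq> {}"
  proof (rule compact_imp_fip_image [OF compact])
    fix \<I> :: "'s set set" assume "finite \<I>" "\<I> \<subseteq> {I. left_ideal I \<and> closed I}"
    then have "left_ideal (\<Inter>\<I>)" using ideal by blast
    then obtain s where "s \<in> \<Inter>\<I>" by (auto simp: left_ideal_def)
    then have "act s x \<in> K \<inter> (\<Inter>I\<in>\<I>. closure ((\<lambda>s. act s x) ` I))"
      using x closure_subset by fastforce
    then show "K \<inter> (\<Inter>I\<in>\<I>. closure ((\<lambda>s. act s x) ` I)) \<noteq> {}" by blast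
  qed auto
  then show ?thesis by (auto simp: limit_set_def)
qed

end

text \<open>Bridges the nonexpansiveness hypothesis, whose left ideals are arbitrary, and limit
  sets, which use closed ones.\<close>

lemma left_ideal_closure:
  fixes I :: "'s::semitopological_semigroup set"
  assumes "left_ideal I"
  shows "left_ideal (closure I)"
proof -
  have "(\<lambda>i. s * i) ` closure I \<subseteq> closure I" for s
  proof (rule image_closure_subset)
    show "continuous_on (closure I) (\<lambda>i. s * i)"
      by (rule continuous_on_subset [OF continuous_on_mult_separate(1)]) auto
    show "(\<lambda>i. s * i) ` I \<subseteq> closure I"
      using assms closure_subset by (fastforce simp: left_ideal_def)
  qed auto
  then show ?thesis using assms by (auto simp: left_ideal_def)
qed

subsection \<open>The fixed point theorem\<close>

context lcs
begin

lemma closed_seminorm_cball: "q \<in> Q \<Longrightarrow> closed {x. q (x - y) \<le> r}"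
  by (intro closed_Collect_le continuous_on_const continuous_on_seminorm)

lemma convex_seminorm_cball:
  assumes "q \<in> Q"
  shows "convex {x. q (x - y) \<le> r}"
proof (rule convexI)
  fix a b and u v :: real
  assume ab: "a \<in> {x. q (x - y) \<le> r}" "b \<in> {x. q (x - y) \<le> r}" and uv: "0 \<le> u" "0 \<le> v" "u + v = 1"
  have "u *\<^sub>R a + v *\<^sub>R b - y = u *\<^sub>R a + v *\<^sub>R b - (u + v) *\<^sub>R y"
    using uv(3) by simp
  also have "\<dots> = u *\<^sub>R (a - y) + v *\<^sub>R (b - y)"
    by (simp add: algebra_simps)
  also have "q \<dots> \<le> u * q (a - y) + v * q (b - y)"
    using seminorm [OF assms] uv unfolding seminorm_def by (metis abs_of_nonneg)
  also have "\<dots> \<le> u * r + v * r"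
    using ab uv by (intro add_mono mult_left_mono) auto
  also have "\<dots> = r" using uv(3) by (metis distrib_right mult_1)
  finally show "u *\<^sub>R a + v *\<^sub>R b \<in> {x. q (x - y) \<le> r}" by simp
qed

text \<open>DeMarr's lemma. The centre of a finite cover of \<open>F\<close> by balls of radius \<open>r / 2\<close>, with \<open>r\<close> the
  diameter, will do: for each \<open>y\<close> at least one of the \<open>n\<close> averaged distances is at most \<open>r / 2\<close>.\<close>

lemma non_diametral_point:
  assumes F: "compact F" and q: "q \<in> Q" and ab: "a \<in> F" "b \<in> F" "0 < q (a - b)"
  obtains u r where "u \<in> convex hull F" "\<And>y. y \<in> F \<Longrightarrow> q (u - y) \<le> r" "\<exists>y\<in>F. \<exists>z\<in>F. r < q (y - z)"
proof -
  note sq = seminorm [OF q]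
  have cont: "continuous_on (F \<times> F) (\<lambda>p. q ((\<lambda>(a, b). a - b) p - 0))"
    by (rule continuous_on_compose2 [OF continuous_on_seminorm [OF q, of UNIV] continuous_on_diff_pair]) auto
  have "F \<times> F \<noteq> {}" using ab(1) by auto
  then obtain p where p: "p \<in> F \<times> F"
    "\<forall>p'\<in>F \<times> F. q ((\<lambda>(a, b). a - b) p' - 0) \<le> q ((\<lambda>(a, b). a - b) p - 0)"
    using continuous_attains_sup [OF compact_Times [OF F F] _ cont] by blast
  define r where "r = q (fst p - snd p)"
  have r: "q (y - z) \<le> r" if "y \<in> F" "z \<in> F" for y z
    using bspec [OF p(2), of "(y, z)"] that by (simp add: r_def case_prod_beta)
  then have r0: "0 < r" using ab by fastforce
  have "F \<subseteq> (\<Union>x\<in>F. {y. q (y - x) < r / 2})"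
    using r0 seminorm_zero [OF sq] by auto
  from compactE_image [OF F open_seminorm_ball [OF q] this] obtain Y
    where Y: "Y \<subseteq> F" "finite Y" "F \<subseteq> (\<Union>x\<in>Y. {y. q (y - x) < r / 2})" by auto
  have "Y \<noteq> {}" using Y(3) ab by auto
  define n where "n = real (card Y)"
  have n: "n > 0" using \<open>Y \<noteq> {}\<close> Y(2) by (simp add: n_def card_gt_0_iff)
  define u where "u = (\<Sum>x\<in>Y. (1 / n) *\<^sub>R x)"
  have "u \<in> convex hull F"
    unfolding u_def
  proof (rule convex_sum [OF Y(2) convex_convex_hull])
    show "(\<Sum>x\<in>Y. 1 / n) = 1" using n by (simp add: n_def)
    show "x \<in> convex hull F" if "x \<in> Y" for x using that Y(1) by (intro hull_inc) auto
  qed (use n in auto)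
  \<comment> \<open>One of the n terms is at most r / 2 and the others are at most r; the mean of
    these bounds is r - r / (2 * n).\<close>
  moreover have "q (u - y) \<le> r - r / (2 * n)" if y: "y \<in> F" for y
  proof -
    obtain x0 where x0: "x0 \<in> Y" "q (y - x0) < r / 2" using Y(3) y by auto
    have "u - y = (\<Sum>x\<in>Y. (1 / n) *\<^sub>R (x - y))"
    proof -
      have "(\<Sum>x\<in>Y. (1 / n) *\<^sub>R y) = y"
        using n by (simp add: n_def sum_constant_scaleR)
      then show ?thesis by (simp add: u_def scaleR_diff_right sum_subtractf)
    qed
    then have "q (u - y) \<le> (\<Sum>x\<in>Y. q ((1 / n) *\<^sub>R (x - y)))"
      using seminorm_sum [OF sq Y(2)] by simp
    also have "\<dots> = (\<Sum>x\<in>Y. q (x - y)) / n"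
      using sq n by (simp add: seminorm_def sum_divide_distrib)
    also have "(\<Sum>x\<in>Y. q (x - y)) = q (x0 - y) + (\<Sum>x\<in>Y - {x0}. q (x - y))"
      using x0(1) Y(2) by (simp add: sum.remove)
    also have "\<dots> \<le> r / 2 + (\<Sum>x\<in>Y - {x0}. r)"
      using x0 seminorm_minus_commute [OF sq, of x0 y] Y(1) y r
      by (intro add_mono sum_mono) auto
    also have "(\<Sum>x\<in>Y - {x0}. r) = (n - 1) * r"
      using x0(1) Y(2) \<open>Y \<noteq> {}\<close> by (simp add: n_def card_Diff_singleton of_nat_diff card_gt_0_iff Suc_leI)
    finally have "q (u - y) \<le> (r / 2 + (n - 1) * r) / n" using n by (simp add: divide_right_mono)
    also have "\<dots> = r - r / (2 * n)" using n by (simp add: field_simps)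
    finally show ?thesis .
  qed
  moreover have "\<exists>y\<in>F. \<exists>z\<in>F. r - r / (2 * n) < q (y - z)"
    using p(1) r0 n by (intro bexI [of _ "fst p"] bexI [of _ "snd p"]) (auto simp: r_def)
  ultimately show ?thesis by (rule that)
qed

end

text \<open>Zorn's lemma for complements. Compactness makes the intersection of a chain nonempty, so
  \<open>chain\<close> may presuppose this.\<close>

lemma minimal_compact:
  fixes \<A> :: "'a::t2_space set set"
  assumes ne: "\<A> \<noteq> {}" and cpt: "\<And>A. A \<in> \<A> \<Longrightarrow> compact A" "\<And>A. A \<in> \<A> \<Longrightarrow> A \<noteq> {}"
    and chain: "\<And>\<C>. \<C> \<noteq> {} \<Longrightarrow> \<C> \<subseteq> \<A> \<Longrightarrow> \<Inter>\<C> \<noteq> {} \<Longrightarrow> \<Inter>\<C> \<in> \<A>"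
  obtains A where "A \<in> \<A>" "\<And>B. B \<in> \<A> \<Longrightarrow> B \<subseteq> A \<Longrightarrow> B = A"
proof -
  have "\<exists>M\<in>uminus ` \<A>. \<forall>X\<in>uminus ` \<A>. M \<subseteq> X \<longrightarrow> X = M"
  proof (rule subset_Zorn_nonempty)
    fix \<C> assume \<C>: "\<C> \<noteq> {}" "subset.chain (uminus ` \<A>) \<C>"
    then have sub: "uminus ` \<C> \<subseteq> \<A>" by (fastforce simp: subset.chain_def)
    \<comment> \<open>In a chain a finite intersection is its smallest member, hence
      nonempty.\<close>
    have fin: "\<Inter>\<F> \<in> \<F>" if "finite \<F>" "\<F> \<noteq> {}" "\<F> \<subseteq> uminus ` \<C>" for \<F>
      using that
    proof (induction \<F> rule: finite_ne_induct)
      case (insert S \<F>)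
      then have "S \<in> uminus ` \<C>" "\<Inter>\<F> \<in> uminus ` \<C>" "\<Inter>\<F> \<in> \<F>" by auto
      moreover have "S \<subseteq> T \<or> T \<subseteq> S" if "S \<in> uminus ` \<C>" "T \<in> uminus ` \<C>" for S T
        using \<C>(2) that unfolding subset_chain_def by (metis Compl_subset_Compl_iff imageE)
      ultimately have "S \<subseteq> \<Inter>\<F> \<or> \<Inter>\<F> \<subseteq> S" by blast
      with \<open>\<Inter>\<F> \<in> \<F>\<close> show ?case by (metis Inter_insert inf.absorb1 inf.absorb2 insertCI)
    qed auto
    obtain A where A: "A \<in> uminus ` \<C>" using \<C>(1) by auto
    have "A \<inter> \<Inter> (uminus ` \<C>) \<noteq> {}"
    proof (rule compact_imp_fip)
      show "compact A" using A sub cpt(1) by auto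
      show "closed T" if "T \<in> uminus ` \<C>" for T
        using that sub cpt(1) compact_imp_closed by blast
      fix \<F> assume "finite \<F>" "\<F> \<subseteq> uminus ` \<C>"
      then have "\<Inter> (insert A \<F>) \<in> insert A \<F>" using A by (intro fin) auto
      then have "\<Inter> (insert A \<F>) \<in> \<A>" using A sub \<open>\<F> \<subseteq> uminus ` \<C>\<close> by auto
      then show "A \<inter> \<Inter>\<F> \<noteq> {}" using cpt(2) by auto
    qed
    then have "\<Inter> (uminus ` \<C>) \<noteq> {}" by blast
    then have "\<Inter> (uminus ` \<C>) \<in> \<A>"
      using \<C>(1) sub by (intro chain) auto
    moreover have "\<Union>\<C> = - \<Inter> (uminus ` \<C>)" by auto
    ultimately show "\<Union>\<C> \<in> uminus ` \<A>" by blast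
  qed (use ne in auto)
  then obtain A where "A \<in> \<A>" "\<forall>B\<in>\<A>. - A \<subseteq> - B \<longrightarrow> - B = - A" by auto
  then show ?thesis by (intro that [of A]) auto
qed

text \<open>The space M enters only through the orbit functions it contains, so one argument serves
  all three cases.\<close>

theorem (in lcs) common_fixed_point_of_mean:
  fixes K :: "'x set" and act :: "'s::semitopological_semigroup \<Rightarrow> 'x \<Rightarrow> 'x"
  assumes R: "right_reversible TYPE('s)" and "compact_action K act"
    and K: "K \<noteq> {}" "convex K" and super: "super_asymp_sep_nonexpansive Q K act"
    and m: "left_invariant_mean M m"
    and orbit: "\<And>x f. x \<in> K \<Longrightarrow> continuous_on K f \<Longrightarrow> orbit_fun act x f \<in> M"
  shows "has_common_fixed_point K act"
proof -
  interpret compact_action K act by fact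
  \<comment> \<open>Stability under limit sets replaces invariance under the action, because
    nonexpansiveness constrains s.x only for s in a left ideal.\<close>
  define \<A> where "\<A> = {A. A \<noteq> {} \<and> compact A \<and> convex A \<and> A \<subseteq> K \<and> (\<forall>x\<in>A. limit_set x \<subseteq> A)}"
  obtain A where A: "A \<in> \<A>" and min: "\<And>B. B \<in> \<A> \<Longrightarrow> B \<subseteq> A \<Longrightarrow> B = A"
  proof (rule minimal_compact [of \<A>])
    have "K \<in> \<A>" using K compact limit_set_subset by (simp add: \<A>_def)
    then show "\<A> \<noteq> {}" by blast
    fix \<C> assume \<C>: "\<C> \<noteq> {}" "\<C> \<subseteq> \<A>" "\<Inter>\<C> \<noteq> {}"
    obtain C where "C \<in> \<C>" using \<C>(1) by blast
    then have "compact C" "\<Inter>\<C> \<subseteq> C" using \<C>(2) by (auto simp: \<A>_def)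
    moreover have "closed (\<Inter>\<C>)"
      using \<C>(2) by (intro closed_Inter ballI compact_imp_closed) (auto simp: \<A>_def)
    ultimately have "compact (\<Inter>\<C>)" by (metis compact_Int_closed inf.absorb_iff2)
    moreover have "convex (\<Inter>\<C>)" using \<C>(2) by (intro convex_Inter) (auto simp: \<A>_def)
    moreover have "\<Inter>\<C> \<subseteq> K" using \<C>(1,2) by (auto simp: \<A>_def)
    moreover have "limit_set x \<subseteq> \<Inter>\<C>" if "x \<in> \<Inter>\<C>" for x
      using \<C>(2) that unfolding \<A>_def by blast
    ultimately show "\<Inter>\<C> \<in> \<A>" using \<C>(3) by (simp add: \<A>_def)
  qed (auto simp: \<A>_def)
  then have AK: "A \<subseteq> K" and cA: "compact A" "convex A" and lim: "\<And>x. x \<in> A \<Longrightarrow> limit_set x \<subseteq> A"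
    by (auto simp: \<A>_def)
  obtain x where x: "x \<in> A" using A by (auto simp: \<A>_def)
  then have xK: "x \<in> K" using AK by blast
  obtain y where y: "y \<in> limit_set x" using limit_set_nonempty [OF R xK] by blast
  then have yK: "y \<in> K" using limit_set_subset [OF xK] by blast
  obtain F where F: "compact F" "F \<noteq> {}" "F \<subseteq> closure (range (\<lambda>s. act s y))" and sF: "\<And>s. act s ` F = F"
    using invariant_set_of_mean [OF m yK orbit [OF yK]] by blast
  \<comment> \<open>The limit set of x is closed and invariant, so it contains the orbit closure of
    y, and with it F.\<close>
  have "closure (range (\<lambda>s. act s y)) \<subseteq> limit_set x"
    by (rule closure_minimal) (use act_limit_set [OF xK y] closed_limit_set in auto)
  then have FA: "F \<subseteq> A" using F(3) lim [OF x] by blast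
  have single: "a = b" if ab: "a \<in> F" "b \<in> F" for a b
  proof (rule ccontr)
    assume "a \<noteq> b"
    then obtain q where q: "q \<in> Q" "0 < q (a - b)" by (rule separating_seminorm)
    obtain u r where u: "u \<in> convex hull F" "\<And>y. y \<in> F \<Longrightarrow> q (u - y) \<le> r" and r: "\<exists>y\<in>F. \<exists>z\<in>F. r < q (y - z)"
      using non_diametral_point [OF F(1) q(1) ab q(2)] by blast
    \<comment> \<open>As r lies below the diameter of F, the set F cannot be contained in B.\<close>
    define B where "B = A \<inter> (\<Inter>y\<in>F. {x. q (x - y) \<le> r})"
    have "u \<in> A" using u(1) FA cA(2) hull_minimal by blast
    then have "B \<noteq> {}" using u(2) by (auto simp: B_def)
    moreover have "compact B"
      unfolding B_def using q(1) by (intro compact_Int_closed cA closed_INT ballI closed_seminorm_cball)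
    moreover have "convex B"
      unfolding B_def using q(1) by (intro convex_Int cA convex_INT convex_seminorm_cball)
    moreover have "limit_set x \<subseteq> B" if xB: "x \<in> B" for x
    proof -
      have xA: "x \<in> A" and xF: "\<And>y. y \<in> F \<Longrightarrow> q (x - y) \<le> r" using xB by (auto simp: B_def)
      have xK: "x \<in> K" using xA AK by blast
      fix t :: 's
      obtain I where I: "left_ideal I"
        "\<And>s y. s \<in> I \<Longrightarrow> y \<in> K \<Longrightarrow> q (act (s * t) x - act (s * t) y) \<le> q (x - y)"
        using super xK q(1) unfolding super_asymp_sep_nonexpansive_def by meson
      \<comment> \<open>The estimate concerns products s * t with s \<in> I, and these again form a
        left ideal.\<close>
      define J where "J = (\<lambda>s. s * t) ` I"
      have "left_ideal J"
        using I(1) by (auto simp: left_ideal_def J_def mult.assoc [symmetric])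
      then have J: "left_ideal (closure J)" by (rule left_ideal_closure)
      have "q (act s x - y) \<le> r" if s: "s \<in> closure J" and y: "y \<in> F" for s y
      proof -
        have "q (act s x - y) \<le> r" if "s \<in> J" for s
        proof -
          obtain i where i: "i \<in> I" "s = i * t" using \<open>s \<in> J\<close> by (auto simp: J_def)
          \<comment> \<open>Here F being mapped onto itself is essential: y is the image of some y'
            in F, so the distance from s.x to y is at most that from x to y'.\<close>
          obtain y' where y': "y' \<in> F" "y = act s y'" using sF [of s] y by blast
          have "q (act s x - y) \<le> q (x - y')"
            using I(2) [OF i(1), of y'] y' FA AK i(2) by auto
          also have "\<dots> \<le> r" by (rule xF [OF y'(1)])
          finally show ?thesis .
        qed
        \<comment> \<open>Continuity of the orbit map of x carries the bound from J to its
          closure.\<close>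
        then have "(\<lambda>s. act s x) ` closure J \<subseteq> {z. q (z - y) \<le> r}"
          by (intro image_closure_subset closed_seminorm_cball q(1)
              continuous_on_subset [OF continuous_on_orbit [OF xK]]) auto
        then show ?thesis using s by auto
      qed
      then have "closure ((\<lambda>s. act s x) ` closure J) \<subseteq> (\<Inter>y\<in>F. {x. q (x - y) \<le> r})"
        using q(1) by (intro closure_minimal closed_INT ballI closed_seminorm_cball) auto
      then show ?thesis
        using limit_set_subset_closure [OF J closed_closure, of x] lim [OF xA] by (auto simp: B_def)
    qed
    moreover have "B \<subseteq> A" by (auto simp: B_def)
    ultimately have "B = A" using AK by (intro min) (auto simp: \<A>_def)
    then have "F \<subseteq> B" using FA by simp
    then have "q (y - z) \<le> r" if "y \<in> F" "z \<in> F" for y z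
      using that unfolding B_def by blast
    then show False using r by (meson not_le)
  qed
  obtain z where z: "z \<in> F" using F(2) by blast
  have "act s z = z" for s
    using single z sF [of s] by blast
  then show ?thesis
    using z FA AK by (auto simp: has_common_fixed_point_def)
qed

theorem theorem3p2:
  fixes Q :: "('x::{real_vector, t2_space} \<Rightarrow> real) set"
    and K :: "'x set"
  assumes "right_reversible TYPE('s::semitopological_semigroup)"
    and "locally_convex_space Q"
    and "K \<noteq> {}" and "compact K" and "convex K"
  shows "((\<exists>m. left_invariant_mean (LUC :: ('s \<Rightarrow>\<^sub>C real) set) m) \<longrightarrow>
      (\<forall>act :: 's \<Rightarrow> 'x \<Rightarrow> 'x.
        action_on K act \<and> jointly_continuous_action K act \<and>
        super_asymp_sep_nonexpansive Q K act \<longrightarrow> has_common_fixed_point K act)) \<and>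
      ((\<exists>m. left_invariant_mean (AP :: ('s \<Rightarrow>\<^sub>C real) set) m) \<longrightarrow>
      (\<forall>act :: 's \<Rightarrow> 'x \<Rightarrow> 'x.
        action_on K act \<and> separately_continuous_action K act \<and> equicontinuous_action K act \<and>
        super_asymp_sep_nonexpansive Q K act \<longrightarrow> has_common_fixed_point K act)) \<and>
      ((\<exists>m. left_invariant_mean (WAP :: ('s \<Rightarrow>\<^sub>C real) set) m) \<longrightarrow>
      (\<forall>act :: 's \<Rightarrow> 'x \<Rightarrow> 'x.
        action_on K act \<and> separately_continuous_action K act \<and> quasi_equicontinuous_action K act \<and>
        super_asymp_sep_nonexpansive Q K act \<longrightarrow> has_common_fixed_point K act))"
proof -
  interpret lcs Q by unfold_locales (rule assms(2))
  have compact_action: "compact_action K act"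
    if "action_on K act" "separately_continuous_action K act" for act :: "'s \<Rightarrow> 'x \<Rightarrow> 'x"
    using that assms(4) by unfold_locales
  note fixed_point = common_fixed_point_of_mean [OF assms(1) _ assms(3,5)]
  have LUC: "has_common_fixed_point K act"
    if m: "left_invariant_mean (LUC :: ('s \<Rightarrow>\<^sub>C real) set) m" and act: "action_on K act"
      and joint: "jointly_continuous_action K act" and super: "super_asymp_sep_nonexpansive Q K act"
    for m and act :: "'s \<Rightarrow> 'x \<Rightarrow> 'x"
  proof -
    have ca: "compact_action K act"
      by (rule compact_action [OF act jointly_imp_separately_continuous_action [OF joint]])
    show ?thesis
      by (rule fixed_point [OF ca super m]) (rule compact_action.orbit_fun_LUC [OF ca joint])
  qed
  have AP: "has_common_fixed_point K act"
    if m: "left_invariant_mean (AP :: ('s \<Rightarrow>\<^sub>C real) set) m" and act: "action_on K act"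
      and separate: "separately_continuous_action K act" and equi: "equicontinuous_action K act"
      and super: "super_asymp_sep_nonexpansive Q K act"
    for m and act :: "'s \<Rightarrow> 'x \<Rightarrow> 'x"
  proof -
    note ca = compact_action [OF act separate]
    show ?thesis
      by (rule fixed_point [OF ca super m]) (rule orbit_fun_AP [OF ca equi])
  qed
  have WAP: "has_common_fixed_point K act"
    if m: "left_invariant_mean (WAP :: ('s \<Rightarrow>\<^sub>C real) set) m" and act: "action_on K act"
      and separate: "separately_continuous_action K act" and quasi: "quasi_equicontinuous_action K act"
      and super: "super_asymp_sep_nonexpansive Q K act"
    for m and act :: "'s \<Rightarrow> 'x \<Rightarrow> 'x"
  proof -
    note ca = compact_action [OF act separate]
    show ?thesis
      by (rule fixed_point [OF ca super m]) (rule compact_action.orbit_fun_WAP [OF ca quasi])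
  qed
  show ?thesis
    using LUC AP WAP by blast
qed

end
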